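(* Let $G$ be an infinite torsion group (every element of $G$ has finite order). Then $G$ is not a hierarchically hyperbolic group, i.e. there is no $\mathfrak S$ for which $(G,\mathfrak S)$ is a hierarchically hyperbolic group.
   Context: **Hierarchically hyperbolic spaces (HHSs).** Let $X$ be a quasigeodesic metric space. An HHS structure $(X,\mathfrak S)$ consists of a set $\mathfrak S$ of *domains*, a constant $E\ge 1$, and for each $U\in\mathfrak S$ a geodesic $E$-hyperbolic space $\mathcal C U$, with the following data and axioms. (Distance between sets means infimal distance. One writes $d_U$ for distance in $\mathcal C U$ and suppresses $\pi_U$: $d_U(x,y)=d_{\mathcal C U}(\pi_U(x),\pi_U(y))$ for $x,y\in X$, $d_U(x,A)=d_{\mathcal C U}(\pi_U(x),A)$ for $A\subseteq\mathcal C U$.) 1. *Projections.* Maps $\pi_U:X\to\mathcal C U$ with $d_U(x,y)\le E\,d_X(x,y)+E$, and every point of $\mathcal C U$ is within $E$ of $\pi_U(X)$. 2. *Nesting.* A partial order $\sqsubseteq$ on $\mathfrak S$ with a unique maximal element (if $\mathfrak S\neq\varnothing$). $V\sqsubset W$ means $V\sqsubseteq W$, $V\ne W$ ("properly nested"). $\mathfrak S_W=\{V:V\sqsubseteq W\}$. If $V\sqsubset W$ there are a specified nonempty $\rho^V_W\subseteq\mathcal C W$ of diameter $\le E$ and a map $\rho^W_V:\mathcal C W\to 2^{\mathcal C V}$. 3. *Orthogonality.* A symmetric antireflexive relation $\bot$. If $V\sqsubseteq W$ and $W\bot U$ then $V\bot U$. If $V\bot W$ then $V,W$ are not $\sqsubseteq$-comparable.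 For each $T\in\mathfrak S$ and $U\in\mathfrak S_T$ with $\{V\in\mathfrak S_T:V\bot U\}\ne\varnothing$ there is $W\in\mathfrak S_T\smallsetminus\{T\}$ such that $V\sqsubseteq W$ whenever $V\in\mathfrak S_T$, $V\bot U$. 4. *Transversality and consistency.* If $V,W$ are distinct, not orthogonal and not $\sqsubseteq$-comparable they are *transverse*, $V\pitchfork W$; then there are nonempty sets $\rho^V_W\subseteq\mathcal C W$, $\rho^W_V\subseteq\mathcal C V$ of diameter $\le E$ with $\min\{d_W(x,\rho^V_W),d_V(x,\rho^W_V)\}\le E$ for all $x\in X$. If $V\sqsubset W$ then $\min\{d_W(x,\rho^V_W),\operatorname{diam}(\{\pi_V(x)\}\cup\rho^W_V(\pi_W(x)))\}\le E$ for all $x\in X$. If $U\sqsubseteq V$ then $d_W(\rho^U_W,\rho^V_W)\le E$ whenever $V\sqsubset W$, or $V\pitchfork W$ and $W\not\perp U$. 5. *Finite complexity.* The cardinality of $\sqsubseteq$-chains is bounded; the maximum is the *complexity*. 6. *Large links.* For $W\in\mathfrak S$, $x,x'\in X$ let $N=E\,d_W(x,x')+E$. There are $T_1,\dots,T_{\lfloor N\rfloor}\in\mathfrak S_W\smallsetminus\{W\}$ such that each $T\in\mathfrak S_W\smallsetminus\{W\}$ is nested in some $T_i$ or has $d_T(x,x')<E$; and $d_W(x,\rho^{T_i}_W)\le N$ for all $i$. 7. *Bounded geodesic image.* If $V\sqsubset W$ and $\gamma$ is a geodesic of $\mathcal C W$, then $\operatorname{diam}\rho^W_V(\gamma)\le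 E$ or $\gamma$ meets the $E$-neighbourhood of $\rho^V_W$. Moreover if $y,z\in X$ have $d_V(y,z)>E$ then $\rho^V_W$ is $E$-close to every geodesic $[\pi_W(y),\pi_W(z)]$. 8. *Partial realisation.* If $\{W_i\}$ are pairwise orthogonal and $p_i\in\mathcal C W_i$, there is $x\in X$ with $d_{W_i}(x,p_i)\le E$ for all $i$ and $d_V(x,\rho^{W_i}_V)\le E$ whenever $W_i\sqsubset V$ or $W_i\pitchfork V$. 9. *Uniqueness.* For each $\kappa$ there is $\theta_u(\kappa)$ such that if $d_X(x,y)>\theta_u(\kappa)$ then $d_U(x,y)>\kappa$ for some $U\in\mathfrak S$. **Hierarchically hyperbolic groups (HHGs).** A finitely generated group $G$ with an HHS structure $(G,\mathfrak S)$ on $G$ (with a word metric) is an HHG if: $G$ acts on $\mathfrak S$ with finitely many orbits, preserving $\sqsubseteq,\bot,\pitchfork$; for $g\in G$, $U\in\mathfrak S$ there is an isometry $g:\mathcal C U\to\mathcal C gU$, with the isometry of a product $gh$ equal to the composition; and $g\pi_U(x)=\pi_{gU}(gx)$, $g\rho^V_U=\rho^{gV}_{gU}$ for all $g,x\in G$ and $U,V$ with $U\pitchfork V$ or $V\sqsubset U$. By cofiniteness, $E$ is also chosen so that $\operatorname{diam}\mathcal C U>E$ implies $\operatorname{diam}\mathcal C U=\infty$. *)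

theory Defs
  imports "HOL-Analysis.Abstract_Metric_Spaces" "HOL-Library.Extended_Nonnegative_Real"
    "HOL-Algebra.Group_Action" "HOL-Algebra.Generated_Groups"
begin

section \<open>Coarse geometry\<close>

text \<open>Both take values in \<^typ>\<open>ennreal\<close>: the distance to the empty set is \<open>\<infinity>\<close>, the diameter
  of the empty set is \<open>0\<close>, and unbounded sets have diameter \<open>\<infinity>\<close>.\<close>

definition set_dist :: "('a \<Rightarrow> 'a \<Rightarrow> real) \<Rightarrow> 'a set \<Rightarrow> 'a set \<Rightarrow> ennreal" where
  "set_dist d A B = (INF a\<in>A. INF b\<in>B. ennreal (d a b))"

definition diam :: "('a \<Rightarrow> 'a \<Rightarrow> real) \<Rightarrow> 'a set \<Rightarrow> ennreal" where
  "diam d A = (SUP a\<in>A. SUP b\<in>A. ennreal (d a b))"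

definition geodesic_on :: "'a set \<Rightarrow> ('a \<Rightarrow> 'a \<Rightarrow> real) \<Rightarrow> real set \<Rightarrow> (real \<Rightarrow> 'a) \<Rightarrow> bool" where
  "geodesic_on M d I \<gamma> \<longleftrightarrow>
     is_interval I \<and> \<gamma> ` I \<subseteq> M \<and> (\<forall>s\<in>I. \<forall>t\<in>I. d (\<gamma> s) (\<gamma> t) = \<bar>s - t\<bar>)"

definition geodesic_segment ::
    "'a set \<Rightarrow> ('a \<Rightarrow> 'a \<Rightarrow> real) \<Rightarrow> 'a \<Rightarrow> 'a \<Rightarrow> 'a set \<Rightarrow> bool" where
  "geodesic_segment M d x y P \<longleftrightarrow>
     (\<exists>\<gamma> l. 0 \<le> l \<and> geodesic_on M d {0..l} \<gamma> \<and> \<gamma> 0 = x \<and> \<gamma> l = y \<and> P = \<gamma> ` {0..l})"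

definition geodesic_space :: "'a set \<Rightarrow> ('a \<Rightarrow> 'a \<Rightarrow> real) \<Rightarrow> bool" where
  "geodesic_space M d \<longleftrightarrow> Metric_space M d \<and> (\<forall>x\<in>M. \<forall>y\<in>M. \<exists>P. geodesic_segment M d x y P)"

definition quasigeodesic_space :: "'a set \<Rightarrow> ('a \<Rightarrow> 'a \<Rightarrow> real) \<Rightarrow> bool" where
  "quasigeodesic_space M d \<longleftrightarrow> Metric_space M d \<and>
     (\<exists>K\<ge>1. \<exists>c\<ge>0. \<forall>x\<in>M. \<forall>y\<in>M. \<exists>l\<ge>0. \<exists>q. q ` {0..l} \<subseteq> M \<and> q 0 = x \<and> q l = y \<and>
        (\<forall>s\<in>{0..l}. \<forall>t\<in>{0..l}.
           \<bar>s - t\<bar> / K - c \<le> d (q s) (q t) \<and> d (q s) (q t) \<le> K * \<bar>s - t\<bar> + c))"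

text \<open>Slim triangles; since \<^const>\<open>geodesic_segment\<close> is symmetric in its endpoints, quantifying
  over all vertices covers each of the three sides.\<close>

definition hyperbolic_space :: "real \<Rightarrow> 'a set \<Rightarrow> ('a \<Rightarrow> 'a \<Rightarrow> real) \<Rightarrow> bool" where
  "hyperbolic_space \<delta> M d \<longleftrightarrow>
     (\<forall>x\<in>M. \<forall>y\<in>M. \<forall>z\<in>M. \<forall>P Q R.
        geodesic_segment M d x y P \<and> geodesic_segment M d y z Q \<and> geodesic_segment M d x z R \<longrightarrow>
        (\<forall>p\<in>P. set_dist d {p} (Q \<union> R) \<le> ennreal \<delta>))"

section \<open>Hierarchically hyperbolic spaces\<close>

text \<open>The usual \<open>\<rho>\<^sup>V\<^sub>W\<close> is split in two. If \<open>V\<close> is properly nested in or transverse to \<open>W\<close>, it is the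
  set \<open>rho S V W \<subseteq> hspace S W\<close>. If \<open>W\<close> is properly nested in \<open>V\<close>, it is the set-valued map
  \<open>rho_map S V W\<close> from \<open>hspace S V\<close> to \<open>hspace S W\<close>. Other values are irrelevant.\<close>

record ('x, 'u, 'p) hhs_structure =
  domains :: "'u set" (\<open>\<SS>\<index>\<close>)
  hspace :: "'u \<Rightarrow> 'p set" (\<open>\<C>\<index>\<close>)
  hdist :: "'u \<Rightarrow> 'p \<Rightarrow> 'p \<Rightarrow> real" (\<open>\<C>dist\<index>\<close>)
  hproj :: "'u \<Rightarrow> 'x \<Rightarrow> 'p" (\<open>\<pi>\<index>\<close>)
  nested :: "'u \<Rightarrow> 'u \<Rightarrow> bool" (infix \<open>\<preceq>\<index>\<close> 50)
  orth :: "'u \<Rightarrow> 'u \<Rightarrow> bool" (infix \<open>\<perp>\<index>\<close> 50)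
  rho :: "'u \<Rightarrow> 'u \<Rightarrow> 'p set"
  rho_map :: "'u \<Rightarrow> 'u \<Rightarrow> 'p \<Rightarrow> 'p set"

definition pnested :: "('x, 'u, 'p, 'm) hhs_structure_scheme \<Rightarrow> 'u \<Rightarrow> 'u \<Rightarrow> bool"
    (infix \<open>\<prec>\<index>\<close> 50) where
  "V \<prec>\<^bsub>S\<^esub> W \<longleftrightarrow> V \<preceq>\<^bsub>S\<^esub> W \<and> V \<noteq> W"

definition transverse :: "('x, 'u, 'p, 'm) hhs_structure_scheme \<Rightarrow> 'u \<Rightarrow> 'u \<Rightarrow> bool"
    (infix \<open>\<pitchfork>\<index>\<close> 50) where
  "V \<pitchfork>\<^bsub>S\<^esub> W \<longleftrightarrow> V \<noteq> W \<and> \<not> V \<perp>\<^bsub>S\<^esub> W \<and> \<not> V \<preceq>\<^bsub>S\<^esub> W \<and> \<not> W \<preceq>\<^bsub>S\<^esub> V"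

definition below :: "('x, 'u, 'p, 'm) hhs_structure_scheme \<Rightarrow> 'u \<Rightarrow> 'u set" where
  "below S W = {V \<in> domains S. V \<preceq>\<^bsub>S\<^esub> W}"

definition pdist :: "('x, 'u, 'p, 'm) hhs_structure_scheme \<Rightarrow> 'u \<Rightarrow> 'x \<Rightarrow> 'x \<Rightarrow> real" where
  "pdist S U x y = hdist S U (hproj S U x) (hproj S U y)"

definition pdist_set :: "('x, 'u, 'p, 'm) hhs_structure_scheme \<Rightarrow> 'u \<Rightarrow> 'x \<Rightarrow> 'p set \<Rightarrow> ennreal" where
  "pdist_set S U x A = set_dist (hdist S U) {hproj S U x} A"

text \<open>In \<open>large_links\<close> the list \<open>T\<^sub>1, \<dots>, T\<^sub>n\<close> with \<open>n = \<lfloor>N\<rfloor>\<close> is rendered as a set of at most \<open>\<lfloor>N\<rfloor>\<close>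
  domains. If some domain is properly nested in \<open>W\<close> this is the same, as lists may have
  repetitions. If \<open>W\<close> is minimal, the set is empty, whereas a list of length exactly \<open>\<lfloor>N\<rfloor> \<ge> 1\<close>
  could not exist.\<close>

locale hierarchically_hyperbolic_space =
  fixes X :: "'x set" and d :: "'x \<Rightarrow> 'x \<Rightarrow> real"
    and S :: "('x, 'u, 'p, 'm) hhs_structure_scheme" (structure) and E :: real
  assumes quasigeodesic: "quasigeodesic_space X d"
    and E_ge_1: "1 \<le> E"
    and geodesic: "\<And>U. U \<in> \<SS> \<Longrightarrow> geodesic_space (\<C> U) (\<C>dist U)"
    and hyperbolic: "\<And>U. U \<in> \<SS> \<Longrightarrow> hyperbolic_space E (\<C> U) (\<C>dist U)"
  \<comment> \<open>projections\<close>
    and proj_in: "\<And>U x. \<lbrakk>U \<in> \<SS>; x \<in> X\<rbrakk> \<Longrightarrow> \<pi> U x \<in> \<C> U"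
    and proj_lipschitz: "\<And>U x y. \<lbrakk>U \<in> \<SS>; x \<in> X; y \<in> X\<rbrakk> \<Longrightarrow> pdist S U x y \<le> E * d x y + E"
    and proj_coarsely_onto:
      "\<And>U p. \<lbrakk>U \<in> \<SS>; p \<in> \<C> U\<rbrakk> \<Longrightarrow> set_dist (\<C>dist U) {p} (\<pi> U ` X) \<le> ennreal E"
  \<comment> \<open>nesting\<close>
    and nested_refl: "\<And>U. U \<in> \<SS> \<Longrightarrow> U \<preceq> U"
    and nested_antisym: "\<And>U V. \<lbrakk>U \<in> \<SS>; V \<in> \<SS>; U \<preceq> V; V \<preceq> U\<rbrakk> \<Longrightarrow> U = V"
    and nested_trans:
      "\<And>U V W. \<lbrakk>U \<in> \<SS>; V \<in> \<SS>; W \<in> \<SS>; U \<preceq> V; V \<preceq> W\<rbrakk> \<Longrightarrow> U \<preceq> W"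
    and unique_maximal: "\<SS> \<noteq> {} \<Longrightarrow> \<exists>!W. W \<in> \<SS> \<and> (\<forall>V\<in>\<SS>. \<not> W \<prec> V)"
    and rho_nested:
      "\<And>V W. \<lbrakk>V \<in> \<SS>; W \<in> \<SS>; V \<prec> W\<rbrakk> \<Longrightarrow>
         rho S V W \<noteq> {} \<and> rho S V W \<subseteq> \<C> W \<and> diam (\<C>dist W) (rho S V W) \<le> ennreal E"
    and rho_map_in:
      "\<And>V W p. \<lbrakk>V \<in> \<SS>; W \<in> \<SS>; V \<prec> W; p \<in> \<C> W\<rbrakk> \<Longrightarrow> rho_map S W V p \<subseteq> \<C> V"
  \<comment> \<open>orthogonality\<close>
    and orth_sym: "\<And>V W. \<lbrakk>V \<in> \<SS>; W \<in> \<SS>; V \<perp> W\<rbrakk> \<Longrightarrow> W \<perp> V"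
    and orth_irrefl: "\<And>V. V \<in> \<SS> \<Longrightarrow> \<not> V \<perp> V"
    and nested_orth:
      "\<And>U V W. \<lbrakk>U \<in> \<SS>; V \<in> \<SS>; W \<in> \<SS>; V \<preceq> W; W \<perp> U\<rbrakk> \<Longrightarrow> V \<perp> U"
    and orth_not_nested:
      "\<And>V W. \<lbrakk>V \<in> \<SS>; W \<in> \<SS>; V \<perp> W\<rbrakk> \<Longrightarrow> \<not> V \<preceq> W \<and> \<not> W \<preceq> V"
    and container:
      "\<And>T U. \<lbrakk>T \<in> \<SS>; U \<in> below S T; {V \<in> below S T. V \<perp> U} \<noteq> {}\<rbrakk> \<Longrightarrow>
         \<exists>W \<in> below S T - {T}. \<forall>V \<in> below S T. V \<perp> U \<longrightarrow> V \<preceq> W"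
  \<comment> \<open>transversality and consistency\<close>
    and rho_transverse:
      "\<And>V W. \<lbrakk>V \<in> \<SS>; W \<in> \<SS>; V \<pitchfork> W\<rbrakk> \<Longrightarrow>
         rho S V W \<noteq> {} \<and> rho S V W \<subseteq> \<C> W \<and> diam (\<C>dist W) (rho S V W) \<le> ennreal E"
    and consistency_transverse:
      "\<And>V W x. \<lbrakk>V \<in> \<SS>; W \<in> \<SS>; V \<pitchfork> W; x \<in> X\<rbrakk> \<Longrightarrow>
         min (pdist_set S W x (rho S V W)) (pdist_set S V x (rho S W V)) \<le> ennreal E"
    and consistency_nested:
      "\<And>V W x. \<lbrakk>V \<in> \<SS>; W \<in> \<SS>; V \<prec> W; x \<in> X\<rbrakk> \<Longrightarrow>
         min (pdist_set S W x (rho S V W))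
             (diam (\<C>dist V) ({\<pi> V x} \<union> rho_map S W V (\<pi> W x))) \<le> ennreal E"
    and rho_close:
      "\<And>U V W. \<lbrakk>U \<in> \<SS>; V \<in> \<SS>; W \<in> \<SS>; U \<preceq> V; V \<prec> W \<or> V \<pitchfork> W \<and> \<not> W \<perp> U\<rbrakk> \<Longrightarrow>
         set_dist (\<C>dist W) (rho S U W) (rho S V W) \<le> ennreal E"
  \<comment> \<open>finite complexity\<close>
    and finite_complexity:
      "\<exists>n. \<forall>C \<subseteq> \<SS>. (\<forall>U\<in>C. \<forall>V\<in>C. U \<preceq> V \<or> V \<preceq> U) \<longrightarrow> finite C \<and> card C \<le> n"
  \<comment> \<open>large links\<close>
    and large_links:
      "\<And>W x x' N. \<lbrakk>W \<in> \<SS>; x \<in> X; x' \<in> X; N = E * pdist S W x x' + E\<rbrakk> \<Longrightarrow>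
         \<exists>\<T> \<subseteq> below S W - {W}. finite \<T> \<and> card \<T> \<le> nat \<lfloor>N\<rfloor> \<and>
           (\<forall>T \<in> below S W - {W}. (\<exists>T'\<in>\<T>. T \<preceq> T') \<or> pdist S T x x' < E) \<and>
           (\<forall>T\<in>\<T>. pdist_set S W x (rho S T W) \<le> ennreal N)"
  \<comment> \<open>bounded geodesic image\<close>
    and bounded_geodesic_image:
      "\<And>V W I \<gamma>. \<lbrakk>V \<in> \<SS>; W \<in> \<SS>; V \<prec> W; geodesic_on (\<C> W) (\<C>dist W) I \<gamma>\<rbrakk> \<Longrightarrow>
         diam (\<C>dist V) (\<Union>p \<in> \<gamma> ` I. rho_map S W V p) \<le> ennreal E \<or>
         (\<exists>p \<in> \<gamma> ` I. set_dist (\<C>dist W) {p} (rho S V W) \<le> ennreal E)"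
    and bounded_geodesic_image':
      "\<And>V W y z P. \<lbrakk>V \<in> \<SS>; W \<in> \<SS>; V \<prec> W; y \<in> X; z \<in> X; pdist S V y z > E;
         geodesic_segment (\<C> W) (\<C>dist W) (\<pi> W y) (\<pi> W z) P\<rbrakk> \<Longrightarrow>
         set_dist (\<C>dist W) (rho S V W) P \<le> ennreal E"
  \<comment> \<open>partial realisation\<close>
    and partial_realisation:
      "\<And>\<W> p. \<lbrakk>\<W> \<subseteq> \<SS>; pairwise (\<lambda>V W. V \<perp> W) \<W>; \<And>W. W \<in> \<W> \<Longrightarrow> p W \<in> \<C> W\<rbrakk> \<Longrightarrow>
         \<exists>x\<in>X. \<forall>W\<in>\<W>. \<C>dist W (\<pi> W x) (p W) \<le> E \<and>
           (\<forall>V\<in>\<SS>. W \<prec> V \<or> W \<pitchfork> V \<longrightarrow> pdist_set S V x (rho S W V) \<le> ennreal E)"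
  \<comment> \<open>uniqueness\<close>
    and uniqueness:
      "\<And>\<kappa>. \<exists>\<theta>. \<forall>x\<in>X. \<forall>y\<in>X. d x y > \<theta> \<longrightarrow> (\<exists>U\<in>\<SS>. pdist S U x y > \<kappa>)"

section \<open>Hierarchically hyperbolic groups\<close>

definition word_length :: "('g, 'b) monoid_scheme \<Rightarrow> 'g set \<Rightarrow> 'g \<Rightarrow> nat" where
  "word_length G A g = (LEAST n. \<exists>ws. length ws = n \<and> set ws \<subseteq> A \<union> m_inv G ` A \<and>
      foldr (\<lambda>a b. a \<otimes>\<^bsub>G\<^esub> b) ws \<one>\<^bsub>G\<^esub> = g)"

text \<open>The value outside the carrier is fixed because \<^locale>\<open>Metric_space\<close> asks for a
  function that is symmetric on the whole type.\<close>

definition word_metric :: "('g, 'b) monoid_scheme \<Rightarrow> 'g set \<Rightarrow> 'g \<Rightarrow> 'g \<Rightarrow> real" where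
  "word_metric G A g h =
     (if g \<in> carrier G \<and> h \<in> carrier G then real (word_length G A (inv\<^bsub>G\<^esub> g \<otimes>\<^bsub>G\<^esub> h)) else 0)"

text \<open>\<open>act g U\<close> is the domain \<open>gU\<close>, and \<open>isom g U\<close> is the isometry induced by \<open>g\<close> from the
  hyperbolic space of \<open>U\<close> to that of \<open>gU\<close>.\<close>

locale hhg_action =
  fixes G :: "('g, 'b) monoid_scheme"
    and S :: "('g, 'u, 'p, 'm) hhs_structure_scheme" (structure)
    and act :: "'g \<Rightarrow> 'u \<Rightarrow> 'u" and isom :: "'g \<Rightarrow> 'u \<Rightarrow> 'p \<Rightarrow> 'p"
  assumes action: "group_action G \<SS> act"
    and cofinite: "finite (orbits G \<SS> act)"
    and act_nested:
      "\<And>g U V. \<lbrakk>g \<in> carrier G; U \<in> \<SS>; V \<in> \<SS>\<rbrakk> \<Longrightarrow> act g U \<preceq> act g V \<longleftrightarrow> U \<preceq> V"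
    and act_orth:
      "\<And>g U V. \<lbrakk>g \<in> carrier G; U \<in> \<SS>; V \<in> \<SS>\<rbrakk> \<Longrightarrow> act g U \<perp> act g V \<longleftrightarrow> U \<perp> V"
    and act_transverse:
      "\<And>g U V. \<lbrakk>g \<in> carrier G; U \<in> \<SS>; V \<in> \<SS>\<rbrakk> \<Longrightarrow> act g U \<pitchfork> act g V \<longleftrightarrow> U \<pitchfork> V"
    and iso_bij:
      "\<And>g U. \<lbrakk>g \<in> carrier G; U \<in> \<SS>\<rbrakk> \<Longrightarrow> bij_betw (isom g U) (\<C> U) (\<C> (act g U))"
    and iso_dist:
      "\<And>g U p q. \<lbrakk>g \<in> carrier G; U \<in> \<SS>; p \<in> \<C> U; q \<in> \<C> U\<rbrakk> \<Longrightarrow>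
         \<C>dist (act g U) (isom g U p) (isom g U q) = \<C>dist U p q"
    and iso_mult:
      "\<And>g h U p. \<lbrakk>g \<in> carrier G; h \<in> carrier G; U \<in> \<SS>; p \<in> \<C> U\<rbrakk> \<Longrightarrow>
         isom (g \<otimes>\<^bsub>G\<^esub> h) U p = isom g (act h U) (isom h U p)"
    and iso_proj:
      "\<And>g U x. \<lbrakk>g \<in> carrier G; U \<in> \<SS>; x \<in> carrier G\<rbrakk> \<Longrightarrow>
         isom g U (\<pi> U x) = \<pi> (act g U) (g \<otimes>\<^bsub>G\<^esub> x)"
    and iso_rho:
      "\<And>g U V. \<lbrakk>g \<in> carrier G; U \<in> \<SS>; V \<in> \<SS>; U \<pitchfork> V \<or> V \<prec> U\<rbrakk> \<Longrightarrow>
         isom g U ` rho S V U = rho S (act g V) (act g U)"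

definition hierarchically_hyperbolic_group ::
    "('g, 'b) monoid_scheme \<Rightarrow> ('g, 'u, 'p, 'm) hhs_structure_scheme \<Rightarrow> bool" where
  "hierarchically_hyperbolic_group G S \<longleftrightarrow> group G \<and>
     (\<exists>A E act isom. finite A \<and> A \<subseteq> carrier G \<and> generate G A = carrier G \<and>
        hierarchically_hyperbolic_space (carrier G) (word_metric G A) S E \<and>
        hhg_action G S act isom \<and>
        (\<forall>U\<in>domains S. diam (hdist S U) (hspace S U) > ennreal E \<longrightarrow>
            diam (hdist S U) (hspace S U) = \<infinity>))"

end

theory Submission
  imports Defs
begin

text \<open>A torsion group cannot act coboundedly on an unbounded hyperbolic space: elements of finite
  order move the base point in such a way that all orbit points lie roughly in one direction
  (\<open>gromov_product_ge_half_min\<close>), as for a horocyclic action, whereas a coarsely dense orbit has points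
  near the midpoint of two far orbit points, which see these in opposite directions. So it suffices
  to find such an action of a subgroup of an infinite hierarchically hyperbolic group \<open>G\<close>.

  As \<open>G\<close> is infinite, the uniqueness axiom provides an unbounded domain, and finite complexity
  provides a domain \<open>U\<close> that is maximal among the unbounded ones. Coarse surjectivity of the
  projections makes the orbit of the stabiliser of \<open>U\<close> coarsely dense in the hyperbolic space of \<open>U\<close>
  as soon as this stabiliser has finite index. So everything rests on the set of maximal
  unbounded domains, on which \<open>G\<close> acts, being finite (\<open>finite_max_unbounded\<close>).

  By the large links axiom, the number of maximal unbounded domains in which two given points are
  at distance at least \<open>E\<close> is bounded independently of the points
  (\<open>card_max_unbounded_large_bounded\<close>). With partial realisation this shows that pairwise orthogonal
  families of maximal unbounded domains are finite. Two distinct maximal unbounded domains are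
  orthogonal or transverse, so transversality remains to be excluded. Consider in each \<open>U\<close>
  the shadow cast by the maximal unbounded domains transverse to it. If all shadows
  are spread out, then transverse domains can be lined up into arbitrarily long chains, in
  all of whose domains two fixed points are far apart (\<open>no_spread_shadows\<close>). If the shadow of some \<open>U\<close> is clustered,
  then translates of \<open>U\<close> with respect to which the identity is farther and farther from the shadow
  are infinitely many and pairwise orthogonal (\<open>shadow_spread\<close>). Both contradict the bounds above.\<close>

section \<open>Distances, diameters and hyperbolicity\<close>

lemma set_dist_singleton_less:
  assumes "set_dist d {p} A \<le> ennreal r" "r < s" "0 \<le> r"
  obtains a where "a \<in> A" "d p a < s"
proof -
  have "set_dist d {p} A < ennreal s"
    using assms by (meson ennreal_lessI le_less_trans order_le_less_trans)
  then obtain a where "a \<in> A" "ennreal (d p a) < ennreal s"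
    by (auto simp: set_dist_def INF_less_iff)
  thus thesis using that assms by (meson ennreal_leI not_le)
qed

lemma diam_le_imp_dist_le:
  assumes "diam d A \<le> ennreal r" "0 \<le> r" "a \<in> A" "b \<in> A"
  shows "d a b \<le> r"
proof -
  have "ennreal (d a b) \<le> diam d A"
    unfolding diam_def using assms(3,4) by (meson SUP_upper SUP_upper2)
  thus ?thesis using assms(1,2) by (meson ennreal_le_iff order_trans)
qed

lemma diam_infinite_imp_far_pair:
  assumes "diam d A = \<infinity>"
  obtains a b where "a \<in> A" "b \<in> A" "r < d a b"
proof -
  have "\<not> (\<forall>a\<in>A. \<forall>b\<in>A. d a b \<le> r)"
  proof
    assume "\<forall>a\<in>A. \<forall>b\<in>A. d a b \<le> r"
    hence "diam d A \<le> ennreal r" unfolding diam_def by (intro SUP_least ennreal_leI) auto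
    thus False using assms by (simp add: top_unique)
  qed
  thus thesis using that by (meson not_le)
qed

lemma dist_less_imp_diam:
  assumes "a \<in> A" "b \<in> A" "r < d a b" "0 \<le> r"
  shows "ennreal r < diam d A"
  using diam_le_imp_dist_le[of d A r a b] assms by (meson not_le)

lemma diam_isometric_image:
  assumes "\<And>a b. \<lbrakk>a \<in> A; b \<in> A\<rbrakk> \<Longrightarrow> d' (f a) (f b) = d a b"
  shows "diam d' (f ` A) = diam d A"
  unfolding diam_def image_image using assms by (intro SUP_cong refl) (auto simp: image_image intro!: SUP_cong)

definition gromov_product :: "('a \<Rightarrow> 'a \<Rightarrow> real) \<Rightarrow> 'a \<Rightarrow> 'a \<Rightarrow> 'a \<Rightarrow> real" where
  "gromov_product d w x y = (d w x + d w y - d x y) / 2"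

context Metric_space begin

lemma gromov_product_le_dist_segment:
  assumes "w \<in> M" "geodesic_segment M d x y P" "p \<in> P"
  shows "gromov_product d w x y \<le> d w p"
proof -
  obtain \<gamma> l t where g: "0 \<le> l" "geodesic_on M d {0..l} \<gamma>" "\<gamma> 0 = x" "\<gamma> l = y" "t \<in> {0..l}" "p = \<gamma> t"
    using assms by (auto simp: geodesic_segment_def)
  hence dd: "d x p = t" "d p y = l - t" "d x y = l" and M: "x \<in> M" "y \<in> M" "p \<in> M"
    by (auto simp: geodesic_on_def)
  show ?thesis using triangle[of w p x] triangle[of w p y] M assms(1) dd
    by (simp add: gromov_product_def commute)
qed

lemma slim_triangle:
  assumes "hyperbolic_space E M d" "1 \<le> E"
    and "x \<in> M" "y \<in> M" "z \<in> M"
    and "geodesic_segment M d x y P" "geodesic_segment M d x z Q" "geodesic_segment M d y z R"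
    and "p \<in> P"
  obtains q where "q \<in> Q \<union> R" "d p q \<le> 2 * E"
proof -
  have "set_dist d {p} (R \<union> Q) \<le> ennreal E"
    using assms unfolding hyperbolic_space_def by metis
  then obtain q where "q \<in> R \<union> Q" "d p q < 2 * E"
    using set_dist_singleton_less[of d p "R \<union> Q" E "2 * E"] assms(2) by force
  thus thesis using that[of q] by auto
qed

text \<open>The Gromov product measures the distance from \<open>w\<close> to a geodesic from \<open>x\<close> to \<open>y\<close>: somewhere on that
  geodesic, the points close to the side \<open>[x,w]\<close> meet the points close to \<open>[y,w]\<close>, and near such a
  point the three sides almost form a tripod.\<close>

lemma dist_segment_le_gromov_product:
  assumes hyp: "hyperbolic_space E M d" and E: "1 \<le> E"
    and w: "w \<in> M" and P: "geodesic_segment M d x y P"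
    and Q: "geodesic_segment M d x w Q" and R: "geodesic_segment M d y w R"
  obtains p where "p \<in> P" "d w p \<le> gromov_product d w x y + 6 * E"
proof -
  obtain \<gamma> l where g: "0 \<le> l" "geodesic_on M d {0..l} \<gamma>" "\<gamma> 0 = x" "\<gamma> l = y" and P_eq: "P = \<gamma> ` {0..l}"
    using P by (auto simp: geodesic_segment_def)
  have M: "x \<in> M" "y \<in> M" and \<gamma>M: "\<And>t. t \<in> {0..l} \<Longrightarrow> \<gamma> t \<in> M"
    and \<gamma>d: "\<And>s t. \<lbrakk>s \<in> {0..l}; t \<in> {0..l}\<rbrakk> \<Longrightarrow> d (\<gamma> s) (\<gamma> t) = \<bar>s - t\<bar>"
    using g by (auto simp: geodesic_on_def)
  have QM: "Q \<subseteq> M" and RM: "R \<subseteq> M"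
    using Q R by (auto simp: geodesic_segment_def geodesic_on_def)
  define T where "T = {t \<in> {0..l}. \<exists>q\<in>Q. d (\<gamma> t) q \<le> 2 * E}"
  have slim: "t \<in> T \<or> (\<exists>r\<in>R. d (\<gamma> t) r \<le> 2 * E)" if t: "t \<in> {0..l}" for t
    using slim_triangle[OF hyp E M w P Q R, of "\<gamma> t"] t by (auto simp: T_def P_eq)
  have x: "x \<in> Q" using Q by (force simp: geodesic_segment_def)
  have y: "y \<in> R" using R by (force simp: geodesic_segment_def)
  have "0 \<in> T" using x g E M by (auto simp: T_def intro!: bexI[of _ x])
  have bdd: "bdd_above T" by (rule bdd_aboveI[of _ l]) (auto simp: T_def)
  \<comment> \<open>The last point close to \<open>[x,w]\<close>, up to \<open>1/2\<close>: the supremum need not be attained, so \<open>t\<close> and \<open>u\<close>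
    are taken on either side of it.\<close>
  obtain t where t: "t \<in> T" "Sup T - 1/2 < t"
    using less_cSup_iff[OF _ bdd, of "Sup T - 1/2"] \<open>0 \<in> T\<close> by auto
  define u where "u = min l (Sup T + 1/2)"
  have t_le: "t \<le> Sup T" using t bdd by (simp add: cSup_upper)
  have tl: "t \<in> {0..l}" using t by (simp add: T_def)
  hence ul: "u \<in> {0..l}" and tu: "\<bar>t - u\<bar> \<le> 1" using t t_le by (auto simp: u_def min_def)
  have "\<exists>r\<in>R. d (\<gamma> u) r \<le> 2 * E"
  proof (cases "u = l")
    case True
    thus ?thesis using y g E M by (auto intro!: bexI[of _ y])
  next
    case False
    hence "u \<notin> T" using bdd cSup_upper[of u T] by (auto simp: u_def min_def split: if_splits)
    thus ?thesis using slim[OF ul] by blast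
  qed
  then obtain r where r: "r \<in> R" "d (\<gamma> u) r \<le> 2 * E" by blast
  obtain q where q: "q \<in> Q" "d (\<gamma> t) q \<le> 2 * E" using t by (auto simp: T_def)
  let ?p = "\<gamma> t"
  have pM: "?p \<in> M" "\<gamma> u \<in> M" "q \<in> M" "r \<in> M" using \<gamma>M tl ul q r QM RM by auto
  have pr: "d ?p r \<le> 3 * E"
    using triangle[of ?p "\<gamma> u" r] \<gamma>d[OF tl ul] tu r E pM by simp
  obtain \<gamma>1 l1 t1 where "0 \<le> l1" "geodesic_on M d {0..l1} \<gamma>1" "\<gamma>1 0 = x" "\<gamma>1 l1 = w" "t1 \<in> {0..l1}" "q = \<gamma>1 t1"
    using Q q by (auto simp: geodesic_segment_def)
  hence 1: "d x w = d x q + d q w" by (auto simp: geodesic_on_def)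
  obtain \<gamma>2 l2 t2 where "0 \<le> l2" "geodesic_on M d {0..l2} \<gamma>2" "\<gamma>2 0 = y" "\<gamma>2 l2 = w" "t2 \<in> {0..l2}" "r = \<gamma>2 t2"
    using R r by (auto simp: geodesic_segment_def)
  hence 2: "d y w = d y r + d r w" by (auto simp: geodesic_on_def)
  have 3: "d x y = d x ?p + d ?p y"
    using \<gamma>d[of 0 t] \<gamma>d[of t l] \<gamma>d[of 0 l] tl g by auto
  have "d w ?p \<le> gromov_product d w x y + 6 * E"
    using 1 2 3 q(2) pr triangle[of x q ?p] triangle[of w q ?p] triangle[of w r ?p] triangle[of ?p r y]
      pM M w E
    by (simp add: gromov_product_def commute field_simps)
  thus thesis using that tl P_eq by blast
qed

text \<open>A point \<open>p\<close> of \<open>[x,z]\<close> nearly realising \<open>(x|z)\<close> is close to \<open>[x,y]\<close> or to \<open>[z,y]\<close>, whose distance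
  from \<open>w\<close> is at least \<open>(x|y)\<close> or \<open>(y|z)\<close>. The constant \<open>8 E\<close> adds the \<open>2 E\<close> of a slim triangle to
  the \<open>6 E\<close> lost at \<open>p\<close>.\<close>

lemma hyperbolic_imp_four_point:
  assumes geo: "geodesic_space M d" and hyp: "hyperbolic_space E M d" and E: "1 \<le> E"
    and M: "w \<in> M" "x \<in> M" "y \<in> M" "z \<in> M"
  shows "min (gromov_product d w x y) (gromov_product d w y z) - 8 * E \<le> gromov_product d w x z"
proof -
  have seg: "\<exists>P. geodesic_segment M d a b P" if "a \<in> M" "b \<in> M" for a b
    using geo that by (auto simp: geodesic_space_def)
  obtain P where P: "geodesic_segment M d x z P" using seg M by blast
  obtain Q where Q: "geodesic_segment M d x w Q" using seg M by blast
  obtain R where R: "geodesic_segment M d z w R" using seg M by blast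
  obtain A where A: "geodesic_segment M d x y A" using seg M by blast
  obtain B where B: "geodesic_segment M d z y B" using seg M by blast
  obtain p where p: "p \<in> P" "d w p \<le> gromov_product d w x z + 6 * E"
    using dist_segment_le_gromov_product[OF hyp E M(1) P Q R] by blast
  obtain q where q: "q \<in> A \<union> B" "d p q \<le> 2 * E"
    using slim_triangle[OF hyp E M(2) M(4) M(3) P A B p(1)] by blast
  have "p \<in> M" "q \<in> M"
    using p q P A B by (auto simp: geodesic_segment_def geodesic_on_def)
  hence "d w q \<le> gromov_product d w x z + 8 * E"
    using triangle[of w p q] p q M by simp
  moreover have "min (gromov_product d w x y) (gromov_product d w y z) \<le> d w q"
    using q gromov_product_le_dist_segment[OF M(1) A, of q] gromov_product_le_dist_segment[OF M(1) B, of q]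
    by (auto simp: min_le_iff_disj gromov_product_def commute add.commute)
  ultimately show ?thesis by simp
qed
end

section \<open>Hyperbolic pseudometrics on torsion groups\<close>

text \<open>The pseudometric \<open>\<rho>\<close> stands for the distance between orbit points \<open>x \<cdot> p\<close> and \<open>y \<cdot> p\<close> of an
  isometric action on a hyperbolic space. Working with \<open>\<rho>\<close> on the group itself forgets the
  space and the action: of a cobounded action on a geodesic space only \<open>coarse_midpoint\<close> is
  kept.\<close>

locale torsion_group_hyperbolic_metric = group K
  for K :: "('g, 'b) monoid_scheme" (structure) +
  fixes \<rho> :: "'g \<Rightarrow> 'g \<Rightarrow> real" and \<delta> R :: real
  assumes torsion: "\<And>g. g \<in> carrier K \<Longrightarrow> \<exists>n::nat. n > 0 \<and> g [^] n = \<one>"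
    and sym: "\<And>x y. \<lbrakk>x \<in> carrier K; y \<in> carrier K\<rbrakk> \<Longrightarrow> \<rho> x y = \<rho> y x"
    and left_invariant: "\<And>g x y. \<lbrakk>g \<in> carrier K; x \<in> carrier K; y \<in> carrier K\<rbrakk> \<Longrightarrow>
      \<rho> (g \<otimes> x) (g \<otimes> y) = \<rho> x y"
    and \<delta>_nonneg: "0 \<le> \<delta>"
    and four_point: "\<And>w x y z. \<lbrakk>w \<in> carrier K; x \<in> carrier K; y \<in> carrier K; z \<in> carrier K\<rbrakk> \<Longrightarrow>
      min (gromov_product \<rho> w x y) (gromov_product \<rho> w y z) - \<delta> \<le> gromov_product \<rho> w x z"
    and coarse_midpoint: "\<And>x y. \<lbrakk>x \<in> carrier K; y \<in> carrier K\<rbrakk> \<Longrightarrow>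
      \<exists>m\<in>carrier K. \<bar>\<rho> m x - \<rho> x y / 2\<bar> \<le> R \<and> \<bar>\<rho> m y - \<rho> x y / 2\<bar> \<le> R"
begin

definition len :: "'g \<Rightarrow> real" where "len g = \<rho> \<one> g"

lemma dist_eq_len:
  assumes "x \<in> carrier K" "y \<in> carrier K" shows "\<rho> x y = len (inv x \<otimes> y)"
  using left_invariant[of "inv x" x y] assms by (simp add: len_def)

lemma len_inv: assumes "g \<in> carrier K" shows "len (inv g) = len g"
  using left_invariant[of g "inv g" \<one>] assms by (simp add: len_def sym)

text \<open>Otherwise \<open>g\<close> is loxodromic: by the four-point inequality, a first step of progress
  \<open>|g\<^sup>2| > |g| + 2\<delta>\<close> propagates along the powers, so that \<open>|g\<^sup>n|\<close> increases strictly for \<open>n \<ge> 1\<close>.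
  But \<open>|g\<^sup>n\<^sup>+\<^sup>1| = |g|\<close> if \<open>g\<^sup>n = 1\<close>.\<close>

lemma len_square_le:
  assumes g: "g \<in> carrier K"
  shows "len (g \<otimes> g) \<le> len g + 2 * \<delta>"
proof (rule ccontr)
  define p where "p n = g [^] (n::nat)" for n
  define a where "a n = len (p n)" for n
  define s where "s = a 2 - a 1 - 2 * \<delta>"
  assume "\<not> ?thesis"
  hence s: "s > 0" using g by (simp add: s_def a_def p_def numeral_2_eq_2)
  have p: "p n \<in> carrier K" for n using g by (simp add: p_def)
  have dist: "\<rho> (p i) (p j) = a (j - i)" if "i \<le> j" for i j
  proof -
    have "p j = p i \<otimes> p (j - i)" using that g by (simp add: p_def nat_pow_mult)
    thus ?thesis using p left_invariant[of "p i" \<one> "p (j - i)"] by (simp add: a_def len_def)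
  qed
  have p0: "p 0 = \<one>" by (simp add: p_def)
  have step: "a (Suc n) + s \<le> a (Suc (Suc n))" for n
  proof (induction n)
    case 0
    show ?case using \<delta>_nonneg by (simp add: s_def numeral_2_eq_2)
  next
    case (Suc n)
    let ?N = "Suc (Suc (Suc n))"
    have "min (gromov_product \<rho> (p 0) (p 1) (p 2)) (gromov_product \<rho> (p 0) (p 2) (p ?N)) - \<delta>
          \<le> gromov_product \<rho> (p 0) (p 1) (p ?N)"
      by (intro four_point p)
    hence "min (a 2 / 2) ((a 2 + a ?N - a (Suc n)) / 2) - \<delta> \<le> (a 1 + a ?N - a (Suc (Suc n))) / 2"
      by (simp add: gromov_product_def dist numeral_2_eq_2)
    hence "a 2 - 2 * \<delta> \<le> a 1 + a ?N - a (Suc (Suc n)) \<or>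
           a 2 + a ?N - a (Suc n) - 2 * \<delta> \<le> a 1 + a ?N - a (Suc (Suc n))"
      by (auto simp: min_def field_simps split: if_splits)
    thus ?case using Suc s unfolding s_def by linarith
  qed
  have "a (Suc 0) < a (Suc (Suc n))" for n
  proof (induction n)
    case 0
    show ?case using step[of 0] s by simp
  next
    case (Suc n)
    show ?case using Suc step[of "Suc n"] s by simp
  qed
  moreover obtain n where n: "n > 0" "g [^] (n::nat) = \<one>" using torsion[OF g] by blast
  then obtain k where k: "n = Suc k" by (cases n) auto
  have "a (Suc n) = a (Suc 0)" using n g by (simp add: a_def p_def)
  ultimately show False using k by (metis less_irrefl)
qed

text \<open>Elements of finite order look parabolic: by \<open>len_square_le\<close>, the geodesics from the base point
  to \<open>x\<close> and to \<open>x\<^sup>-\<^sup>1\<close> agree along half of their length. If \<open>g\<close> and \<open>h\<close> pointed in different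
  directions, that is, if \<open>c = (g|h)\<close> were small, then with \<open>f = g\<^sup>-\<^sup>1\<close> the product \<open>fh\<close> would be long,
  start in the direction of \<open>f\<close> and end, seen from its inverse, in that of \<open>h\<^sup>-\<^sup>1\<close>. As \<open>fh\<close> also has
  finite order, \<open>f\<close> and \<open>h\<^sup>-\<^sup>1\<close> point in the same direction. Applying the agreement of an element
  with its inverse to \<open>g\<close> and \<open>h\<close> as well, so do \<open>g\<close> and \<open>h\<close>.\<close>

lemma gromov_product_ge_half_min:
  assumes g: "g \<in> carrier K" and h: "h \<in> carrier K"
  shows "min (len g) (len h) / 2 - 3 * \<delta> \<le> gromov_product \<rho> \<one> g h"
proof -
  define P where "P = gromov_product \<rho> \<one>"
  have P_def': "P x y = (len x + len y - len (inv x \<otimes> y)) / 2"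
    if "x \<in> carrier K" "y \<in> carrier K" for x y
    using dist_eq_len[OF that] by (simp add: P_def gromov_product_def len_def)
  have P_sym: "P x y = P y x" if "x \<in> carrier K" "y \<in> carrier K" for x y
    using sym[OF that] by (simp add: P_def gromov_product_def)
  have P_four: "min (P x y) (P y z) - \<delta> \<le> P x z"
    if "x \<in> carrier K" "y \<in> carrier K" "z \<in> carrier K" for x y z
    unfolding P_def by (intro four_point that one_closed)
  have P_inv: "len x / 2 - \<delta> \<le> P (inv x) x" if "x \<in> carrier K" for x
    using len_square_le[OF that] that by (simp add: P_def' len_inv)
  define f where "f = inv g"
  have f: "f \<in> carrier K" and len_f: "len f = len g" using g by (simp_all add: f_def len_inv)
  define c where "c = P g h"
  have fh: "f \<otimes> h \<in> carrier K" using f h by simp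
  have c: "len (f \<otimes> h) = len f + len h - 2 * c"
    unfolding c_def by (subst P_def'[OF g h]) (simp add: f_def len_inv g field_simps)
  have "inv (f \<otimes> h) \<otimes> f = inv h"
    using f h by (simp add: inv_mult_group m_assoc)
  hence c1: "P (f \<otimes> h) f = len f - c"
    using c f h by (subst P_def') (simp_all add: len_inv)
  have "f \<otimes> h \<otimes> inv h = f" using f h by (simp add: m_assoc)
  hence c2: "P (inv (f \<otimes> h)) (inv h) = len h - c"
    using c f h fh by (subst P_def') (simp_all add: len_inv)
  have "min (len f) (len h) - c - 3 * \<delta> \<le> P f (inv h)"
  proof -
    have "min (P f (f \<otimes> h)) (P (f \<otimes> h) (inv (f \<otimes> h))) - \<delta> \<le> P f (inv (f \<otimes> h))"
      "min (P f (inv (f \<otimes> h))) (P (inv (f \<otimes> h)) (inv h)) - \<delta> \<le> P f (inv h)"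
      using f h by (auto intro!: P_four)
    moreover have "P f (f \<otimes> h) = len f - c" using c1 P_sym f fh by simp
    moreover have "P (f \<otimes> h) (inv (f \<otimes> h)) \<ge> min (len f) (len h) - c - \<delta>"
      using P_inv[OF fh] P_sym[OF fh] fh c by (simp add: field_simps min_def)
    ultimately show ?thesis using c2 \<delta>_nonneg by (auto simp: min_def split: if_splits)
  qed
  moreover have "min (P g f) (P f (inv h)) - \<delta> \<le> P g (inv h)"
    "min (P g (inv h)) (P (inv h) h) - \<delta> \<le> P g h"
    using f g h by (auto intro!: P_four)
  moreover have "len g / 2 - \<delta> \<le> P g f" "len h / 2 - \<delta> \<le> P (inv h) h"
    using P_inv g h P_sym[OF g f] by (auto simp: f_def)
  ultimately show ?thesis
    using \<delta>_nonneg unfolding len_f P_def[symmetric] c_def by (auto simp: min_def split: if_splits)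
qed

text \<open>At a coarse midpoint \<open>m\<close> of \<open>1\<close> and \<open>g\<close> these two points lie in opposite directions, so their
  Gromov product based at \<open>m\<close> is about \<open>0\<close>; but translating \<open>m\<close> to \<open>1\<close> and using
  \<open>gromov_product_ge_half_min\<close>, it is about \<open>|g|/4\<close> or more.\<close>

lemma len_le: assumes g: "g \<in> carrier K" shows "len g \<le> 6 * R + 12 * \<delta>"
proof -
  obtain m where m: "m \<in> carrier K" and m1: "\<bar>\<rho> m \<one> - len g / 2\<bar> \<le> R" and mg: "\<bar>\<rho> m g - len g / 2\<bar> \<le> R"
    using coarse_midpoint[OF one_closed g] by (auto simp: len_def)
  have l: "len (inv m) = \<rho> m \<one>" "len (inv m \<otimes> g) = \<rho> m g"
    using m g by (simp_all add: len_inv dist_eq_len sym)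
  have "\<rho> (inv m) (inv m \<otimes> g) = len g"
    using left_invariant[of "inv m" \<one> g] m g by (simp add: len_def)
  hence "gromov_product \<rho> \<one> (inv m) (inv m \<otimes> g) = (\<rho> m \<one> + \<rho> m g - len g) / 2"
    by (simp add: gromov_product_def l[unfolded len_def] len_def)
  moreover have "min (\<rho> m \<one>) (\<rho> m g) / 2 - 3 * \<delta> \<le> gromov_product \<rho> \<one> (inv m) (inv m \<otimes> g)"
    using gromov_product_ge_half_min[of "inv m" "inv m \<otimes> g"] m g l by simp
  ultimately have "min (\<rho> m \<one>) (\<rho> m g) / 2 - 3 * \<delta> \<le> (\<rho> m \<one> + \<rho> m g - len g) / 2" by simp
  thus ?thesis using m1 mg by (auto simp: min_def abs_le_iff split: if_splits)
qed

theorem bounded: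
  assumes "x \<in> carrier K" "y \<in> carrier K" shows "\<rho> x y \<le> 6 * R + 12 * \<delta>"
  using len_le[of "inv x \<otimes> y"] dist_eq_len assms by simp

end

section \<open>Maximal unbounded domains\<close>

definition unbounded_domains :: "('x, 'u, 'p, 'm) hhs_structure_scheme \<Rightarrow> 'u set" where
  "unbounded_domains S = {U \<in> domains S. diam (hdist S U) (hspace S U) = \<infinity>}"

definition max_unbounded :: "('x, 'u, 'p, 'm) hhs_structure_scheme \<Rightarrow> 'u set" where
  "max_unbounded S = {U \<in> unbounded_domains S. \<forall>V\<in>unbounded_domains S. \<not> U \<prec>\<^bsub>S\<^esub> V}"

locale hhs_dichotomy = hierarchically_hyperbolic_space X d S E
  for X :: "'x set" and d and S :: "('x, 'u, 'p, 'm) hhs_structure_scheme" (structure) and E +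
  assumes bounded_or_unbounded: "\<And>U. \<lbrakk>U \<in> \<SS>; ennreal E < diam (\<C>dist U) (\<C> U)\<rbrakk> \<Longrightarrow>
    diam (\<C>dist U) (\<C> U) = \<infinity>"
begin

abbreviation \<MM> :: "'u set" where "\<MM> \<equiv> max_unbounded S"

lemma max_unbounded_domain: "U \<in> \<MM> \<Longrightarrow> U \<in> \<SS>"
  by (simp add: max_unbounded_def unbounded_domains_def)

lemma metric: "U \<in> \<SS> \<Longrightarrow> Metric_space (\<C> U) (\<C>dist U)"
  using geodesic by (simp add: geodesic_space_def)

text \<open>Chains have bounded length, so among the chains through \<open>V\<close> that have a top element there is
  a longest one, and its top element cannot be exceeded.\<close>

lemma exists_maximal_above:
  assumes \<Q>: "\<Q> \<subseteq> \<SS>" and V: "V \<in> \<Q>"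
  obtains W where "W \<in> \<Q>" "V \<preceq> W" "\<forall>Z\<in>\<Q>. \<not> W \<prec>\<^bsub>S\<^esub> Z"
proof -
  define chain where "chain C \<longleftrightarrow> C \<subseteq> \<Q> \<and> V \<in> C \<and> (\<forall>U\<in>C. \<forall>V\<in>C. U \<preceq> V \<or> V \<preceq> U)" for C
  define topped where "topped = (\<lambda>(C, W). chain C \<and> W \<in> C \<and> (\<forall>U\<in>C. U \<preceq> W))"
  obtain n where n: "\<And>C. C \<subseteq> \<SS> \<Longrightarrow> \<forall>U\<in>C. \<forall>V\<in>C. U \<preceq> V \<or> V \<preceq> U \<Longrightarrow> finite C \<and> card C \<le> n"
    using finite_complexity by blast
  have fin: "finite C \<and> card C \<le> n" if "chain C" for C
    using n[of C] that \<Q> by (auto simp: chain_def)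
  have "topped ({V}, V)" using V \<Q> nested_refl by (auto simp: topped_def chain_def)
  moreover have "\<forall>y. topped y \<longrightarrow> card (fst y) < Suc n" using fin by (auto simp: topped_def less_Suc_eq_le)
  ultimately have "\<exists>x. topped x \<and> (\<forall>y. topped y \<longrightarrow> card (fst y) \<le> card (fst x))"
    by (rule ex_has_greatest_nat)
  then obtain C W where CW: "topped (C, W)" and max: "\<And>C' W'. topped (C', W') \<Longrightarrow> card C' \<le> card C"
    by auto
  have C: "chain C" "W \<in> C" "\<forall>U\<in>C. U \<preceq> W" using CW by (auto simp: topped_def)
  have sub: "C \<subseteq> \<SS>" using C \<Q> by (auto simp: chain_def)
  have "\<not> W \<prec>\<^bsub>S\<^esub> Z" if Z: "Z \<in> \<Q>" for Z
  proof
    assume WZ: "W \<prec>\<^bsub>S\<^esub> Z"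
    have "W \<in> \<SS>" "Z \<in> \<SS>" using C sub Z \<Q> by auto
    hence "\<forall>U\<in>C. U \<preceq> Z"
      using C sub WZ nested_trans unfolding pnested_def by blast
    moreover have "Z \<notin> C"
      using C sub WZ Z \<Q> nested_antisym[of W Z] by (auto simp: pnested_def)
    ultimately have "topped (insert Z C, Z)"
      using C Z \<Q> nested_refl[of Z] by (auto simp: topped_def chain_def)
    from max[OF this] show False using \<open>Z \<notin> C\<close> fin[OF C(1)] by simp
  qed
  moreover have "W \<in> \<Q>" "V \<preceq> W" using C by (auto simp: chain_def)
  ultimately show thesis using that by blast
qed

lemma obtain_top_domain:
  assumes "\<SS> \<noteq> {}"
  obtains T where "T \<in> \<SS>" "\<And>V. V \<in> \<SS> \<Longrightarrow> V \<preceq> T"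
proof -
  obtain T where T: "T \<in> \<SS>" "\<And>W. \<lbrakk>W \<in> \<SS>; \<forall>V\<in>\<SS>. \<not> W \<prec>\<^bsub>S\<^esub> V\<rbrakk> \<Longrightarrow> W = T"
    using unique_maximal[OF assms] by blast
  have "V \<preceq> T" if V: "V \<in> \<SS>" for V
  proof -
    obtain W where "W \<in> \<SS>" "V \<preceq> W" "\<forall>Z\<in>\<SS>. \<not> W \<prec>\<^bsub>S\<^esub> Z"
      by (rule exists_maximal_above[OF subset_refl V])
    thus ?thesis using T(2) by blast
  qed
  thus thesis using that[of T] T(1) by blast
qed

lemma max_unbounded_not_pnested: "\<lbrakk>U \<in> \<MM>; V \<in> \<MM>\<rbrakk> \<Longrightarrow> \<not> U \<prec>\<^bsub>S\<^esub> V"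
  by (auto simp: max_unbounded_def)

lemma max_unbounded_trichotomy:
  "\<lbrakk>U \<in> \<MM>; V \<in> \<MM>; U \<noteq> V; \<not> U \<perp> V\<rbrakk> \<Longrightarrow> U \<pitchfork> V"
  using max_unbounded_not_pnested by (auto simp: transverse_def pnested_def)

lemma transverse_sym: "\<lbrakk>U \<in> \<SS>; V \<in> \<SS>; U \<pitchfork> V\<rbrakk> \<Longrightarrow> V \<pitchfork> U"
  using orth_sym by (auto simp: transverse_def)

text \<open>Induction on the complexity of \<open>W\<close>. A domain properly above a maximal unbounded one is bounded,
  so its diameter is at most \<open>E\<close> and the large links axiom for \<open>W\<close> provides at most \<open>E\<^sup>2 + E\<close> domains
  properly below \<open>W\<close> that cover \<open>F\<close>; each of them has smaller complexity.\<close>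

lemma card_max_unbounded_large_le:
  assumes "\<And>C. \<lbrakk>C \<subseteq> below S W; \<forall>U\<in>C. \<forall>V\<in>C. U \<preceq> V \<or> V \<preceq> U\<rbrakk> \<Longrightarrow> finite C \<and> card C \<le> k"
    and "W \<in> \<SS>" "finite F" "F \<subseteq> \<MM> \<inter> below S W" and x: "x \<in> X" and y: "y \<in> X"
    and "\<And>V. V \<in> F \<Longrightarrow> E \<le> pdist S V x y"
  shows "card F \<le> nat \<lfloor>E * E + E\<rfloor> ^ k"
  using assms
proof (induction k arbitrary: W F)
  case 0
  have "W \<in> below S W" using 0 nested_refl by (simp add: below_def)
  thus ?case using "0.prems"(1)[of "{W}"] "0.prems"(2) nested_refl by simp
next
  case (Suc k)
  let ?N = "nat \<lfloor>E * E + E\<rfloor>"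
  have "1 \<le> E * E + E" using E_ge_1 by (simp add: add_increasing)
  hence N: "1 \<le> ?N" by (simp add: le_nat_iff)
  show ?case
  proof (cases "F \<subseteq> {W}")
    case True
    hence "card F \<le> 1" using card_mono[OF _ True] by simp
    also have "1 \<le> ?N ^ Suc k" using N by (metis one_le_power)
    finally show ?thesis .
  next
    case False
    then obtain V where V: "V \<in> F" "V \<prec>\<^bsub>S\<^esub> W" using Suc.prems(4) by (auto simp: below_def pnested_def)
    have "W \<notin> \<MM>" using max_unbounded_not_pnested V Suc.prems(4) by blast
    have "\<not> ennreal E < diam (\<C>dist W) (\<C> W)"
      using bounded_or_unbounded[of W] V Suc.prems
      by (auto simp: max_unbounded_def unbounded_domains_def)
    hence "pdist S W x y \<le> E"
      unfolding pdist_def using E_ge_1 Suc.prems x y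
      by (intro diam_le_imp_dist_le[of "\<C>dist W" "\<C> W"] proj_in) auto
    hence le: "E * pdist S W x y + E \<le> E * E + E" using E_ge_1 by simp
    obtain \<T> where \<T>: "\<T> \<subseteq> below S W - {W}" "finite \<T>"
        "card \<T> \<le> nat \<lfloor>E * pdist S W x y + E\<rfloor>"
      and cover: "\<And>T. T \<in> below S W - {W} \<Longrightarrow> (\<exists>T'\<in>\<T>. T \<preceq> T') \<or> pdist S T x y < E"
      using large_links[OF Suc.prems(2) x y refl] by blast
    have "card \<T> \<le> ?N" using \<T>(3) le by (meson floor_mono nat_mono order_trans)
    have F_cover: "F \<subseteq> (\<Union>T\<in>\<T>. F \<inter> below S T)"
    proof
      fix U assume U: "U \<in> F"
      hence "U \<noteq> W" using \<open>W \<notin> \<MM>\<close> Suc.prems by auto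
      hence "\<exists>T'\<in>\<T>. U \<preceq> T'" using cover[of U] U Suc.prems(4) Suc.prems(7)[OF U] by force
      thus "U \<in> (\<Union>T\<in>\<T>. F \<inter> below S T)" using U Suc.prems(4) by (auto simp: below_def)
    qed
    have each: "card (F \<inter> below S T) \<le> ?N ^ k" if T: "T \<in> \<T>" for T
    proof (rule Suc.IH)
      have TW: "T \<in> \<SS>" "T \<preceq> W" "T \<noteq> W" using T \<T> by (auto simp: below_def)
      show "T \<in> \<SS>" by fact
      fix C assume C: "C \<subseteq> below S T" "\<forall>U\<in>C. \<forall>V\<in>C. U \<preceq> V \<or> V \<preceq> U"
      have CW: "\<forall>U\<in>C. U \<preceq> W" using C TW Suc.prems(2) nested_trans[of _ T W] by (auto simp: below_def)
      have "W \<notin> C" using C TW Suc.prems(2) nested_antisym[of T W] by (auto simp: below_def)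
      have "finite (insert W C) \<and> card (insert W C) \<le> Suc k"
        by (rule Suc.prems(1)) (use C CW Suc.prems(2) nested_refl in \<open>auto simp: below_def\<close>)
      thus "finite C \<and> card C \<le> k" using \<open>W \<notin> C\<close> by auto
    qed (use Suc.prems in auto)
    have "card F \<le> card (\<Union>T\<in>\<T>. F \<inter> below S T)"
      using F_cover \<T>(2) Suc.prems(3) by (intro card_mono) auto
    also have "\<dots> \<le> (\<Sum>T\<in>\<T>. card (F \<inter> below S T))" using \<T>(2) by (rule card_UN_le)
    also have "\<dots> \<le> card \<T> * ?N ^ k" using each sum_bounded_above[of \<T> _ "?N ^ k"] by simp
    also have "\<dots> \<le> ?N ^ Suc k" using \<open>card \<T> \<le> ?N\<close> by simp
    finally show ?thesis .
  qed
qed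

lemma card_max_unbounded_large_bounded:
  "\<exists>n. \<forall>F x y. finite F \<and> F \<subseteq> \<MM> \<and> x \<in> X \<and> y \<in> X \<and> (\<forall>V\<in>F. E \<le> pdist S V x y) \<longrightarrow> card F \<le> n"
proof (cases "\<SS> = {}")
  case True
  hence "\<MM> = {}" by (auto simp: max_unbounded_def unbounded_domains_def)
  thus ?thesis by auto
next
  case False
  then obtain T where T: "T \<in> \<SS>" "\<And>V. V \<in> \<SS> \<Longrightarrow> V \<preceq> T" using obtain_top_domain by blast
  obtain k where k: "\<And>C. C \<subseteq> \<SS> \<Longrightarrow> \<forall>U\<in>C. \<forall>V\<in>C. U \<preceq> V \<or> V \<preceq> U \<Longrightarrow> finite C \<and> card C \<le> k"
    using finite_complexity by blast
  have "\<MM> \<subseteq> below S T" using T max_unbounded_domain by (auto simp: below_def)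
  have "card F \<le> nat \<lfloor>E * E + E\<rfloor> ^ k"
    if F: "finite F" "F \<subseteq> \<MM>" "x \<in> X" "y \<in> X" "\<forall>V\<in>F. E \<le> pdist S V x y" for F x y
  proof (rule card_max_unbounded_large_le[OF _ T(1) F(1) _ F(3,4)])
    show "finite C \<and> card C \<le> k"
      if "C \<subseteq> below S T" "\<forall>U\<in>C. \<forall>V\<in>C. U \<preceq> V \<or> V \<preceq> U" for C
      using k[OF _ that(2)] that(1) by (auto simp: below_def)
    show "F \<subseteq> \<MM> \<inter> below S T" using F(2) \<open>\<MM> \<subseteq> below S T\<close> by simp
  qed (use F(5) in blast)
  thus ?thesis by blast
qed

lemma far_point:
  assumes U: "U \<in> \<MM>" and p: "p \<in> \<C> U"
  obtains x where "x \<in> X" "r < \<C>dist U (\<pi> U x) p"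
proof -
  have US: "U \<in> \<SS>" and "diam (\<C>dist U) (\<C> U) = \<infinity>"
    using U by (auto simp: max_unbounded_def unbounded_domains_def)
  obtain a b where ab: "a \<in> \<C> U" "b \<in> \<C> U" "2 * (r + 2 * E) < \<C>dist U a b"
    by (rule diam_infinite_imp_far_pair[OF \<open>diam _ _ = \<infinity>\<close>])
  interpret Metric_space "\<C> U" "\<C>dist U" by (rule metric[OF US])
  have "r + 2 * E < \<C>dist U a p \<or> r + 2 * E < \<C>dist U b p"
    using triangle[of a p b] ab p by (auto simp: commute)
  then obtain q where q: "q \<in> \<C> U" "r + 2 * E < \<C>dist U q p" using ab by blast
  obtain x where x: "x \<in> X" "\<C>dist U q (\<pi> U x) < 2 * E"
    using set_dist_singleton_less[OF proj_coarsely_onto[OF US q(1)], of "2 * E"] E_ge_1 by force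
  have "r < \<C>dist U (\<pi> U x) p"
    using triangle[of q "\<pi> U x" p] q x p proj_in[OF US x(1)] by simp
  thus thesis using that x by blast
qed

text \<open>Partial realisation moves a point independently in all coordinates of an orthogonal family.
  Hence it yields two points that are far apart in as many of its domains as one likes, against the
  uniform bound above.\<close>

lemma finite_pairwise_orthogonal:
  assumes "\<W> \<subseteq> \<MM>" "pairwise (\<lambda>V W. V \<perp> W) \<W>" "X \<noteq> {}"
  shows "finite \<W>"
proof (rule ccontr)
  assume "infinite \<W>"
  obtain n where n: "\<forall>F x y. finite F \<and> F \<subseteq> \<MM> \<and> x \<in> X \<and> y \<in> X \<and>
      (\<forall>V\<in>F. E \<le> pdist S V x y) \<longrightarrow> card F \<le> n"
    using card_max_unbounded_large_bounded by blast
  obtain F where F: "F \<subseteq> \<W>" "finite F" "card F = Suc n"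
    using infinite_arbitrarily_large[OF \<open>infinite \<W>\<close>] by blast
  obtain x where x: "x \<in> X" using assms by blast
  have "\<exists>q \<in> \<C> W. 2 * E < \<C>dist W q (\<pi> W x)" if "W \<in> F" for W
  proof -
    have W: "W \<in> \<MM>" using that F assms(1) by blast
    obtain y where "y \<in> X" "2 * E < \<C>dist W (\<pi> W y) (\<pi> W x)"
      by (rule far_point[OF W proj_in[OF max_unbounded_domain[OF W] x]])
    thus ?thesis using proj_in[OF max_unbounded_domain[OF W]] by blast
  qed
  then obtain q where q: "\<And>W. W \<in> F \<Longrightarrow> q W \<in> \<C> W \<and> 2 * E < \<C>dist W (q W) (\<pi> W x)" by metis
  have "pairwise (\<lambda>V W. V \<perp> W) F" using assms(2) F(1) by (rule pairwise_subset)
  moreover have FS: "F \<subseteq> \<SS>" using F assms(1) max_unbounded_domain by blast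
  ultimately obtain y where y: "y \<in> X" "\<And>W. W \<in> F \<Longrightarrow> \<C>dist W (\<pi> W y) (q W) \<le> E"
    using partial_realisation[of F q] q by blast
  have "E \<le> pdist S W x y" if W: "W \<in> F" for W
  proof -
    have WS: "W \<in> \<SS>" using W FS by blast
    interpret Metric_space "\<C> W" "\<C>dist W" by (rule metric[OF WS])
    show ?thesis
      using triangle[of "q W" "\<pi> W y" "\<pi> W x"] q[OF W] y(2)[OF W] proj_in[OF WS] x y(1)
      by (simp add: pdist_def commute)
  qed
  hence "card F \<le> n" using n F assms(1) x y(1) by blast
  thus False using F by simp
qed

text \<open>The loss from \<open>E\<close> to \<open>3 E\<close> covers the diameter of \<open>A\<close> and the fact that the infimal distance need
  not be attained.\<close>

lemma close_to_set:
  assumes "U \<in> \<SS>" "x \<in> X" "A \<subseteq> \<C> U" "diam (\<C>dist U) A \<le> ennreal E" "a \<in> A"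
    and "pdist_set S U x A \<le> ennreal E"
  shows "\<C>dist U (\<pi> U x) a \<le> 3 * E"
proof -
  interpret Metric_space "\<C> U" "\<C>dist U" by (rule metric[OF assms(1)])
  obtain b where b: "b \<in> A" "\<C>dist U (\<pi> U x) b < 2 * E"
    using set_dist_singleton_less[OF assms(6)[unfolded pdist_set_def], of "2 * E"] E_ge_1 by force
  have "\<C>dist U b a \<le> E" using diam_le_imp_dist_le[OF assms(4)] E_ge_1 b assms(5) by simp
  thus ?thesis using triangle[of "\<pi> U x" b a] b assms proj_in[of U x] by fastforce
qed

lemma transverse_consistency:
  assumes V: "V \<in> \<SS>" and W: "W \<in> \<SS>" and VW: "V \<pitchfork> W" and x: "x \<in> X"
    and a: "a \<in> rho S V W" and b: "b \<in> rho S W V"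
  shows "\<C>dist W (\<pi> W x) a \<le> 3 * E \<or> \<C>dist V (\<pi> V x) b \<le> 3 * E"
  using consistency_transverse[OF V W VW x] rho_transverse[OF V W VW]
    rho_transverse[OF W V transverse_sym[OF V W VW]]
    close_to_set[OF W x _ _ a] close_to_set[OF V x _ _ b]
  by (auto simp: min_le_iff_disj)

text \<open>What can be seen in \<open>U\<close> of the maximal unbounded domains transverse to \<open>U\<close>. By consistency, a
  point of \<open>X\<close> that is far from the shadow in \<open>U\<close> is pinned down in all those domains.\<close>

definition shadow :: "'u \<Rightarrow> 'p set" where
  "shadow U = (\<Union>V\<in>{V \<in> \<MM>. V \<pitchfork> U}. rho S V U)"

lemma shadow_subset: "U \<in> \<MM> \<Longrightarrow> shadow U \<subseteq> \<C> U"
  using rho_transverse max_unbounded_domain by (fastforce simp: shadow_def)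

text \<open>If shadows are spread out, every transverse pair \<open>V \<pitchfork> U\<close> extends by some \<open>U'\<close> transverse to \<open>U\<close>
  whose trace in \<open>U\<close> is far from that of \<open>V\<close>. Iterating yields arbitrarily long chains of transverse
  domains, and by consistency a point far out in the last domain is far from the starting point
  \<open>x\<close> in each of the earlier ones. This contradicts the uniform bound on the number of maximal
  unbounded domains in which two points are far apart.\<close>

lemma no_spread_shadows:
  assumes spread: "\<And>U a. \<lbrakk>U \<in> \<MM>; a \<in> shadow U\<rbrakk> \<Longrightarrow> \<exists>b\<in>shadow U. 7 * E < \<C>dist U a b"
    and UM: "U \<in> \<MM>" and X: "X \<noteq> {}"
  shows "shadow U = {}"
proof (rule ccontr)
  assume ne: "shadow U \<noteq> {}"
  \<comment> \<open>A chain with past domains \<open>F\<close> and last domains \<open>V\<close>, \<open>U\<close>. Whatever lies beyond \<open>a\<close> as seen in \<open>U\<close>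
    is far from \<open>x\<close> in all past domains, but within a distance \<open>B\<close>. The upper bound is what shows
    that the next domain is not a past one: points can be arbitrarily far out in the next domain.\<close>
  define stage where "stage F x U V a B \<longleftrightarrow> finite F \<and> F \<subseteq> \<MM> \<and> x \<in> X \<and> U \<in> \<MM> \<and> V \<in> \<MM> \<and> V \<pitchfork> U \<and>
     a \<in> rho S V U \<and> \<C>dist U (\<pi> U x) a \<le> 3 * E \<and> U \<notin> F \<and>
     (\<forall>y\<in>X. 3 * E < \<C>dist U (\<pi> U y) a \<longrightarrow> (\<forall>W\<in>F. E \<le> pdist S W x y \<and> pdist S W x y \<le> B))"
    for F x U V a B
  have stages: "\<exists>F x U V a B. stage F x U V a B \<and> card F = n" for n
  proof (induction n)
    case 0
    obtain V a where V: "V \<in> \<MM>" "V \<pitchfork> U" and a: "a \<in> rho S V U" using ne by (auto simp: shadow_def)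
    have S: "U \<in> \<SS>" "V \<in> \<SS>" using UM V max_unbounded_domain by auto
    have UV: "U \<pitchfork> V" using transverse_sym S V by blast
    then obtain b where b: "b \<in> rho S U V" "b \<in> \<C> V" using rho_transverse[OF S] by blast
    obtain x where x: "x \<in> X" "3 * E < \<C>dist V (\<pi> V x) b" by (rule far_point[OF V(1) b(2)])
    hence "\<C>dist U (\<pi> U x) a \<le> 3 * E"
      using transverse_consistency[OF S UV x(1) b(1) a] by auto
    hence "stage {} x U V a 0" using x UM V a by (auto simp: stage_def)
    thus ?case by (meson card.empty)
  next
    case (Suc n)
    then obtain F x U V a B where st: "stage F x U V a B" and n: "card F = n" by blast
    have F: "finite F" "F \<subseteq> \<MM>" "U \<notin> F" and x: "x \<in> X" and UVM: "U \<in> \<MM>" "V \<in> \<MM>" "V \<pitchfork> U"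
      and a: "a \<in> rho S V U" "\<C>dist U (\<pi> U x) a \<le> 3 * E"
      and B: "\<And>y W. \<lbrakk>y \<in> X; 3 * E < \<C>dist U (\<pi> U y) a; W \<in> F\<rbrakk> \<Longrightarrow> E \<le> pdist S W x y \<and> pdist S W x y \<le> B"
      using st unfolding stage_def by auto
    have US: "U \<in> \<SS>" using UVM max_unbounded_domain by blast
    interpret CU: Metric_space "\<C> U" "\<C>dist U" by (rule metric[OF US])
    have a_shadow: "a \<in> shadow U" using UVM a by (auto simp: shadow_def)
    then obtain b where "b \<in> shadow U" and ab: "7 * E < \<C>dist U a b" using spread UVM by blast
    then obtain U' where U': "U' \<in> \<MM>" "U' \<pitchfork> U" and b: "b \<in> rho S U' U" by (auto simp: shadow_def)
    have ab_in: "a \<in> \<C> U" "b \<in> \<C> U" using shadow_subset[OF UVM(1)] a_shadow \<open>b \<in> shadow U\<close> by auto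
    have U'S: "U' \<in> \<SS>" using U' max_unbounded_domain by blast
    interpret CU': Metric_space "\<C> U'" "\<C>dist U'" by (rule metric[OF U'S])
    have UU': "U \<pitchfork> U'" using transverse_sym U' US U'S by blast
    then obtain a' where a': "a' \<in> rho S U U'" "a' \<in> \<C> U'" using rho_transverse[OF US U'S] by blast
    note px = proj_in[OF US x] proj_in[OF U'S x]
    \<comment> \<open>In \<open>U\<close> the point \<open>x\<close> is within \<open>3 E\<close> of \<open>a\<close>, and a point beyond \<open>a'\<close> as seen in \<open>U'\<close> is within \<open>3 E\<close> of \<open>b\<close>;
      \<open>7 E\<close> between \<open>a\<close> and \<open>b\<close> keeps them \<open>E\<close> apart.\<close>
    have "7 * E \<le> \<C>dist U (\<pi> U x) b + 3 * E"
      using CU.triangle[of a "\<pi> U x" b] ab a(2) ab_in px by (simp add: CU.commute)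
    hence xa': "\<C>dist U' (\<pi> U' x) a' \<le> 3 * E"
      using transverse_consistency[OF US U'S UU' x a'(1) b] E_ge_1 by auto
    define B' where "B' = max B (\<C>dist U (\<pi> U x) b + 3 * E)"
    have new: "E \<le> pdist S W x y \<and> pdist S W x y \<le> B'"
      if y: "y \<in> X" and ya': "3 * E < \<C>dist U' (\<pi> U' y) a'" and W: "W \<in> insert U F" for y W
    proof -
      have yb: "\<C>dist U (\<pi> U y) b \<le> 3 * E"
        using transverse_consistency[OF US U'S UU' y a'(1) b] ya' by auto
      note py = proj_in[OF US y]
      have ya: "4 * E < \<C>dist U (\<pi> U y) a"
        using CU.triangle[of a "\<pi> U y" b] ab yb ab_in py by (simp add: CU.commute)
      show ?thesis
      proof (cases "W = U")
        case True
        show ?thesis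
          using CU.triangle[of "\<pi> U y" "\<pi> U x" a] CU.triangle[of "\<pi> U x" b "\<pi> U y"] ya a(2) yb ab_in py px True
          by (simp add: pdist_def B'_def CU.commute)
      next
        case False
        thus ?thesis using B[OF y, of W] ya W E_ge_1 by (auto simp: B'_def)
      qed
    qed
    obtain y where y: "y \<in> X" "max (3 * E) (B' + 3 * E) < \<C>dist U' (\<pi> U' y) a'"
      using far_point[OF U'(1) a'(2)] by blast
    have "U' \<notin> insert U F"
    proof
      assume "U' \<in> insert U F"
      hence "pdist S U' x y \<le> B'" using new y by auto
      thus False
        using CU'.triangle[of "\<pi> U' y" "\<pi> U' x" a'] xa' y(2) a'(2) px proj_in[OF U'S y(1)]
        by (simp add: pdist_def CU'.commute)
    qed
    hence "stage (insert U F) x U' U a' B'"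
      using F x UVM U' UU' a' xa' new unfolding stage_def by auto
    moreover have "card (insert U F) = Suc n" using F n by simp
    ultimately show ?case by blast
  qed
  obtain n where n: "\<forall>F x y. finite F \<and> F \<subseteq> \<MM> \<and> x \<in> X \<and> y \<in> X \<and>
      (\<forall>V\<in>F. E \<le> pdist S V x y) \<longrightarrow> card F \<le> n"
    using card_max_unbounded_large_bounded by blast
  obtain F x U V a B where st: "stage F x U V a B" and "card F = Suc n" using stages[of "Suc n"] by blast
  have UM': "U \<in> \<MM>" and "a \<in> shadow U" using st by (auto simp: stage_def shadow_def)
  hence "a \<in> \<C> U" using shadow_subset by blast
  obtain y where "y \<in> X" "3 * E < \<C>dist U (\<pi> U y) a" by (rule far_point[OF UM' \<open>a \<in> \<C> U\<close>])
  hence "card F \<le> n" using n st unfolding stage_def by blast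
  thus False using \<open>card F = Suc n\<close> by simp
qed

end

section \<open>The group action on the maximal unbounded domains\<close>

locale hhg_dichotomy = group G + hhs_dichotomy "carrier G" d S E + hhg_action G S act isom
  for G :: "('g, 'b) monoid_scheme" (structure) and d
    and S :: "('g, 'u, 'p, 'm) hhs_structure_scheme" (structure) and E act isom
begin

lemma act_domain: "\<lbrakk>g \<in> carrier G; U \<in> domains S\<rbrakk> \<Longrightarrow> act g U \<in> domains S"
  using group_action.element_image[OF action] by blast

lemma act_inv_cancel:
  "\<lbrakk>g \<in> carrier G; U \<in> domains S\<rbrakk> \<Longrightarrow> act (inv\<^bsub>G\<^esub> g) (act g U) = U"
  "\<lbrakk>g \<in> carrier G; U \<in> domains S\<rbrakk> \<Longrightarrow> act g (act (inv\<^bsub>G\<^esub> g) U) = U"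
  using group_action.orbit_sym_aux[OF action, of g U] group_action.orbit_sym_aux[OF action, of "inv\<^bsub>G\<^esub> g" U]
  by auto

lemma act_unbounded:
  assumes g: "g \<in> carrier G" and U: "U \<in> unbounded_domains S"
  shows "act g U \<in> unbounded_domains S"
proof -
  have US: "U \<in> domains S" using U by (simp add: unbounded_domains_def)
  have "diam (hdist S (act g U)) (isom g U ` hspace S U) = diam (hdist S U) (hspace S U)"
    by (rule diam_isometric_image) (rule iso_dist[OF g US])
  thus ?thesis using U iso_bij[OF g US] act_domain[OF g US]
    by (simp add: unbounded_domains_def bij_betw_def)
qed

lemma act_max_unbounded:
  assumes g: "g \<in> carrier G" and U: "U \<in> \<MM>"
  shows "act g U \<in> \<MM>"
proof -
  have UU: "U \<in> unbounded_domains S" and US: "U \<in> domains S"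
    using U by (auto simp: max_unbounded_def unbounded_domains_def)
  have "\<not> act g U \<prec>\<^bsub>S\<^esub> V" if V: "V \<in> unbounded_domains S" for V
  proof
    assume gUV: "act g U \<prec>\<^bsub>S\<^esub> V"
    have VS: "V \<in> domains S" using V by (simp add: unbounded_domains_def)
    define V' where "V' = act (inv\<^bsub>G\<^esub> g) V"
    have V': "V' \<in> unbounded_domains S" "V' \<in> domains S" "act g V' = V"
      using act_unbounded act_domain act_inv_cancel g V VS by (auto simp: V'_def)
    have "U \<prec>\<^bsub>S\<^esub> V'" using gUV act_nested[OF g US V'(2)] V'(3) by (auto simp: pnested_def)
    thus False using U V' by (simp add: max_unbounded_def)
  qed
  thus ?thesis using act_unbounded[OF g UU] by (simp add: max_unbounded_def)
qed

lemma pdist_equivariant: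
  assumes "g \<in> carrier G" "U \<in> domains S" "x \<in> carrier G" "y \<in> carrier G"
  shows "pdist S (act g U) (g \<otimes>\<^bsub>G\<^esub> x) (g \<otimes>\<^bsub>G\<^esub> y) = pdist S U x y"
  using iso_proj[of g U] iso_dist[of g U "hproj S U x" "hproj S U y"] assms proj_in
  by (simp add: pdist_def)

lemma shadow_act_subset:
  assumes g: "g \<in> carrier G" and U: "U \<in> \<MM>"
  shows "shadow (act g U) \<subseteq> isom g U ` shadow U"
proof
  fix b assume "b \<in> shadow (act g U)"
  then obtain V where V: "V \<in> \<MM>" "V \<pitchfork>\<^bsub>S\<^esub> act g U" and b: "b \<in> rho S V (act g U)"
    by (auto simp: shadow_def)
  define V' where "V' = act (inv\<^bsub>G\<^esub> g) V"
  have S: "U \<in> domains S" "V \<in> domains S" using U V max_unbounded_domain by auto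
  have V': "V' \<in> \<MM>" "act g V' = V" and V'S: "V' \<in> domains S"
    using act_max_unbounded act_inv_cancel g V S max_unbounded_domain by (auto simp: V'_def)
  have tr: "V' \<pitchfork>\<^bsub>S\<^esub> U" using act_transverse[OF g V'S S(1)] V V' by simp
  hence "isom g U ` rho S V' U = rho S V (act g U)"
    using iso_rho[OF g S(1) V'S] transverse_sym[OF V'S S(1)] V' by simp
  moreover have "rho S V' U \<subseteq> shadow U" using V' tr by (auto simp: shadow_def)
  ultimately show "b \<in> isom g U ` shadow U" using b by blast
qed

lemma shadow_act:
  assumes g: "g \<in> carrier G" and U: "U \<in> \<MM>"
  shows "shadow (act g U) = isom g U ` shadow U"
proof
  show "shadow (act g U) \<subseteq> isom g U ` shadow U" by (rule shadow_act_subset[OF g U])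
  show "isom g U ` shadow U \<subseteq> shadow (act g U)"
  proof
    fix b assume "b \<in> isom g U ` shadow U"
    then obtain V a where V: "V \<in> \<MM>" "V \<pitchfork>\<^bsub>S\<^esub> U" and a: "a \<in> rho S V U" "b = isom g U a"
      by (auto simp: shadow_def)
    have S: "U \<in> domains S" "V \<in> domains S" using U V max_unbounded_domain by auto
    have "isom g U ` rho S V U = rho S (act g V) (act g U)"
      using iso_rho[OF g S] transverse_sym[OF S(2,1)] V by simp
    moreover have "act g V \<in> \<MM>" "act g V \<pitchfork>\<^bsub>S\<^esub> act g U"
      using act_max_unbounded g V act_transverse[OF g S(2,1)] by auto
    ultimately show "b \<in> shadow (act g U)" using a by (auto simp: shadow_def)
  qed
qed

text \<open>Otherwise the shadow of \<open>U\<close> is clustered around \<open>a\<close>. Translating points of \<open>G\<close> that are ever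
  farther from \<open>a\<close> in \<open>U\<close> to the identity turns \<open>U\<close> into infinitely many domains whose clustered
  shadows are far from the identity. By consistency at the identity two such domains cannot be
  transverse, so they form an infinite pairwise orthogonal family.\<close>

lemma shadow_spread:
  assumes U: "U \<in> \<MM>" and a: "a \<in> shadow U"
  shows "\<exists>b\<in>shadow U. 7 * E < hdist S U a b"
proof (rule ccontr)
  assume "\<not> ?thesis"
  hence clustered: "\<And>b. b \<in> shadow U \<Longrightarrow> hdist S U a b \<le> 7 * E" by (meson not_le)
  define base where "base W = hproj S W \<one>\<^bsub>G\<^esub>" for W
  define \<W> where "\<W> = {W \<in> \<MM>. \<exists>a\<in>shadow W. 10 * E < hdist S W (base W) a \<and>
    (\<forall>b\<in>shadow W. hdist S W a b \<le> 7 * E)}"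
  have base_in: "base W \<in> hspace S W" if "W \<in> \<MM>" for W
    unfolding base_def using that max_unbounded_domain by (auto intro: proj_in)
  have far: "3 * E < hdist S W (base W) b" if W: "W \<in> \<W>" and b: "b \<in> shadow W" for W b
  proof -
    have WM: "W \<in> \<MM>" using W by (simp add: \<W>_def)
    interpret Metric_space "hspace S W" "hdist S W" by (rule metric[OF max_unbounded_domain[OF WM]])
    obtain a where a: "a \<in> shadow W" "10 * E < hdist S W (base W) a" "hdist S W a b \<le> 7 * E"
      using W b by (auto simp: \<W>_def)
    have "a \<in> hspace S W" "b \<in> hspace S W" using a b shadow_subset[OF WM] by auto
    thus ?thesis
      using triangle[of "base W" b a] a(2,3) base_in[OF WM] by (simp add: commute)
  qed
  have "V \<perp>\<^bsub>S\<^esub> W" if VW: "V \<in> \<W>" "W \<in> \<W>" "V \<noteq> W" for V W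
  proof (rule ccontr)
    assume "\<not> V \<perp>\<^bsub>S\<^esub> W"
    moreover have M: "V \<in> \<MM>" "W \<in> \<MM>" using VW by (auto simp: \<W>_def)
    ultimately have tr: "V \<pitchfork>\<^bsub>S\<^esub> W" using max_unbounded_trichotomy VW by blast
    have S: "V \<in> domains S" "W \<in> domains S" using M max_unbounded_domain by auto
    have tr': "W \<pitchfork>\<^bsub>S\<^esub> V" using transverse_sym[OF S tr] .
    obtain p q where pq: "p \<in> rho S V W" "q \<in> rho S W V"
      using rho_transverse[OF S tr] rho_transverse[OF S(2,1) tr'] by blast
    hence "p \<in> shadow W" "q \<in> shadow V" using M tr tr' by (auto simp: shadow_def)
    thus False
      using transverse_consistency[OF S tr one_closed pq] far[OF VW(1)] far[OF VW(2)]
      by (force simp: base_def)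
  qed
  hence "pairwise (\<lambda>V W. V \<perp>\<^bsub>S\<^esub> W) \<W>" by (auto simp: pairwise_def)
  hence fin: "finite \<W>"
    by (rule finite_pairwise_orthogonal[rotated]) (auto simp: \<W>_def)
  have "\<exists>r. \<forall>b\<in>shadow W. hdist S W (base W) b \<le> r" if W: "W \<in> \<W>" for W
  proof -
    have WM: "W \<in> \<MM>" using W by (simp add: \<W>_def)
    interpret Metric_space "hspace S W" "hdist S W" by (rule metric[OF max_unbounded_domain[OF WM]])
    obtain a where a: "a \<in> shadow W" "\<And>b. b \<in> shadow W \<Longrightarrow> hdist S W a b \<le> 7 * E"
      using W by (auto simp: \<W>_def)
    have "hdist S W (base W) b \<le> hdist S W (base W) a + 7 * E" if "b \<in> shadow W" for b
      using triangle[of "base W" a b] a(1) a(2)[OF that] that shadow_subset[OF WM] base_in[OF WM] by force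
    thus ?thesis by blast
  qed
  then obtain r where r: "\<And>W b. W \<in> \<W> \<Longrightarrow> b \<in> shadow W \<Longrightarrow> hdist S W (base W) b \<le> r W" by metis
  \<comment> \<open>A translate of \<open>U\<close> whose shadow is beyond all those of the finitely many members of \<open>\<W>\<close>.\<close>
  define R where "R = Max (insert (10 * E) (r ` \<W>))"
  have R: "10 * E \<le> R" "\<And>W. W \<in> \<W> \<Longrightarrow> r W \<le> R" using fin by (auto simp: R_def)
  have US: "U \<in> domains S" and aC: "a \<in> hspace S U" and sub: "shadow U \<subseteq> hspace S U"
    using U a shadow_subset max_unbounded_domain by auto
  obtain g where g: "g \<in> carrier G" "R < hdist S U (hproj S U g) a" using far_point[OF U aC] by blast
  define h where "h = inv\<^bsub>G\<^esub> g"
  define W where "W = act h U"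
  have h: "h \<in> carrier G" "h \<otimes>\<^bsub>G\<^esub> g = \<one>\<^bsub>G\<^esub>" using g by (simp_all add: h_def)
  have WM: "W \<in> \<MM>" using act_max_unbounded h U by (simp add: W_def)
  have sh: "shadow W = isom h U ` shadow U" using shadow_act h U by (simp add: W_def)
  have "base W = isom h U (hproj S U g)" using iso_proj[OF h(1) US g(1)] h by (simp add: base_def W_def)
  hence far_a: "R < hdist S W (base W) (isom h U a)"
    using iso_dist[OF h(1) US proj_in[OF US g(1)] aC] g by (simp add: W_def)
  have cl: "hdist S W (isom h U a) (isom h U b) \<le> 7 * E" if "b \<in> shadow U" for b
    using iso_dist[OF h(1) US aC] that sub clustered by (auto simp: W_def)
  have "W \<in> \<W>"
    unfolding \<W>_def
  proof (intro CollectI conjI bexI[of _ "isom h U a"] WM)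
    show "10 * E < hdist S W (base W) (isom h U a)" using far_a R(1) by simp
  qed (use cl a sh in auto)
  thus False using r[of W "isom h U a"] R(2)[of W] far_a sh a by force
qed

lemma finite_max_unbounded: "finite \<MM>"
proof (rule finite_pairwise_orthogonal)
  have "V \<perp>\<^bsub>S\<^esub> W" if VW: "V \<in> \<MM>" "W \<in> \<MM>" "V \<noteq> W" for V W
  proof (rule ccontr)
    assume "\<not> V \<perp>\<^bsub>S\<^esub> W"
    hence tr: "V \<pitchfork>\<^bsub>S\<^esub> W" using max_unbounded_trichotomy VW by blast
    hence "rho S V W \<subseteq> shadow W" "rho S V W \<noteq> {}"
      using rho_transverse[of V W] VW max_unbounded_domain by (auto simp: shadow_def)
    thus False using no_spread_shadows[OF shadow_spread VW(2)] by auto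
  qed
  thus "pairwise (\<lambda>V W. V \<perp>\<^bsub>S\<^esub> W) \<MM>" by (auto simp: pairwise_def)
qed auto

text \<open>The stabiliser has finite index, since the orbit of \<open>U\<close> lies in the finite set of maximal
  unbounded domains. The element \<open>t W\<close> is a representative of the coset of those \<open>g\<close> with
  \<open>g\<^sup>-\<^sup>1U = W\<close>.\<close>

lemma stabilizer_coarsely_dense:
  assumes U: "U \<in> \<MM>"
  obtains R where "\<And>g. g \<in> carrier G \<Longrightarrow> \<exists>h\<in>stabilizer G act U. pdist S U g h \<le> R"
proof -
  have US: "U \<in> domains S" using U max_unbounded_domain by blast
  define t where "t W = (SOME g. g \<in> carrier G \<and> act (inv\<^bsub>G\<^esub> g) U = W)" for W
  define R where "R = Max ((\<lambda>W. pdist S U (t W) \<one>\<^bsub>G\<^esub>) ` \<MM>)"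
  have "\<exists>h\<in>stabilizer G act U. pdist S U g h \<le> R" if g: "g \<in> carrier G" for g
  proof -
    define W where "W = act (inv\<^bsub>G\<^esub> g) U"
    have "t W \<in> carrier G \<and> act (inv\<^bsub>G\<^esub> (t W)) U = W"
      unfolding t_def by (rule someI[of _ g]) (simp add: g W_def)
    hence t: "t W \<in> carrier G" "act (inv\<^bsub>G\<^esub> (t W)) U = W" by auto
    define h where "h = g \<otimes>\<^bsub>G\<^esub> inv\<^bsub>G\<^esub> (t W)"
    have h: "h \<in> carrier G" using g t by (simp add: h_def)
    have hU: "act h U = U"
      using group_action.composition_rule[OF action US g inv_closed[OF t(1)]] t(2)
        act_inv_cancel(2)[OF g US] by (simp add: h_def W_def)
    have "g = h \<otimes>\<^bsub>G\<^esub> t W" using g t by (simp add: h_def m_assoc)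
    hence "pdist S U g h = pdist S U (t W) \<one>\<^bsub>G\<^esub>"
      using pdist_equivariant[OF h US t(1) one_closed] hU h by simp
    also have "\<dots> \<le> R"
      unfolding R_def using finite_max_unbounded act_max_unbounded[OF inv_closed[OF g] U]
      by (intro Max_ge) (auto simp: W_def)
    finally show ?thesis using h hU by (auto simp: stabilizer_def)
  qed
  thus thesis using that by blast
qed

text \<open>The stabiliser of a maximal unbounded domain \<open>U\<close> is coarsely dense in the unbounded space
  \<open>\<C> U\<close>, so it inherits its coarse midpoints, and the results on torsion groups apply to it.\<close>

theorem max_unbounded_empty_if_torsion:
  assumes torsion: "\<And>g. g \<in> carrier G \<Longrightarrow> \<exists>n::nat. n > 0 \<and> g [^]\<^bsub>G\<^esub> n = \<one>\<^bsub>G\<^esub>"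
  shows "\<MM> = {}"
proof (rule ccontr)
  assume "\<MM> \<noteq> {}"
  then obtain U where U: "U \<in> \<MM>" by blast
  have US: "U \<in> domains S" using U max_unbounded_domain by blast
  interpret Metric_space "hspace S U" "hdist S U" by (rule metric[OF US])
  define H where "H = stabilizer G act U"
  define K where "K = G\<lparr>carrier := H\<rparr>"
  have H: "subgroup H G" using group_action.stabilizer_subgroup[OF action US] by (simp add: H_def)
  have HG: "\<And>h. h \<in> H \<Longrightarrow> h \<in> carrier G" using subgroup.subset[OF H] by blast
  have K: "carrier K = H" "\<And>x y. x \<otimes>\<^bsub>K\<^esub> y = x \<otimes>\<^bsub>G\<^esub> y" "\<one>\<^bsub>K\<^esub> = \<one>\<^bsub>G\<^esub>" by (simp_all add: K_def)
  obtain R0 where R0: "\<And>g. g \<in> carrier G \<Longrightarrow> \<exists>h\<in>H. pdist S U g h \<le> R0"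
    using stabilizer_coarsely_dense[OF U] unfolding H_def by blast
  define R where "R = R0 + 2 * E"
  note P = proj_in[OF US]
  have dense: "\<exists>h\<in>H. hdist S U p (hproj S U h) \<le> R" if p: "p \<in> hspace S U" for p
  proof -
    obtain g where g: "g \<in> carrier G" "hdist S U p (hproj S U g) < 2 * E"
      using set_dist_singleton_less[OF proj_coarsely_onto[OF US p], of "2 * E"] E_ge_1 by force
    obtain h where h: "h \<in> H" "pdist S U g h \<le> R0" using R0 g by blast
    show ?thesis
      using triangle[OF p P P, of g h] g h HG by (intro bexI[of _ h]) (auto simp: pdist_def R_def)
  qed
  interpret Stab: torsion_group_hyperbolic_metric K "pdist S U" "8 * E" R
  proof (intro torsion_group_hyperbolic_metric.intro torsion_group_hyperbolic_metric_axioms.intro)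
    show "group K" using subgroup.subgroup_is_group[OF H] is_group by (simp add: K_def)
    show "\<exists>n::nat. n > 0 \<and> g [^]\<^bsub>K\<^esub> n = \<one>\<^bsub>K\<^esub>" if "g \<in> carrier K" for g
      using torsion[of g] that HG by (simp add: K_def nat_pow_consistent[of _ _ H, symmetric])
    show "pdist S U (g \<otimes>\<^bsub>K\<^esub> x) (g \<otimes>\<^bsub>K\<^esub> y) = pdist S U x y"
      if "g \<in> carrier K" "x \<in> carrier K" "y \<in> carrier K" for g x y
    proof -
      have "act g U = U" using that(1) by (simp add: K(1) H_def stabilizer_def)
      moreover have "g \<in> carrier G" "x \<in> carrier G" "y \<in> carrier G" using that HG by (simp_all add: K(1))
      ultimately show ?thesis using pdist_equivariant[of g U x y] US by (simp add: K(2))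
    qed
    show "min (gromov_product (pdist S U) w x y) (gromov_product (pdist S U) w y z) - 8 * E
        \<le> gromov_product (pdist S U) w x z"
      if "w \<in> carrier K" "x \<in> carrier K" "y \<in> carrier K" "z \<in> carrier K" for w x y z
      using hyperbolic_imp_four_point[OF geodesic[OF US] hyperbolic[OF US] E_ge_1
          P[OF HG] P[OF HG] P[OF HG] P[OF HG], of w x y z] that
      by (simp add: K(1) gromov_product_def pdist_def)
    show "\<exists>m\<in>carrier K. \<bar>pdist S U m x - pdist S U x y / 2\<bar> \<le> R \<and> \<bar>pdist S U m y - pdist S U x y / 2\<bar> \<le> R"
      if xy: "x \<in> carrier K" "y \<in> carrier K" for x y
    proof -
      have xy_in: "hproj S U x \<in> hspace S U" "hproj S U y \<in> hspace S U" using P[OF HG] xy by (simp_all add: K(1))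
      obtain Q where "geodesic_segment (hspace S U) (hdist S U) (hproj S U x) (hproj S U y) Q"
        using geodesic[OF US] xy_in unfolding geodesic_space_def by blast
      then obtain \<gamma> l where \<gamma>: "0 \<le> l" "geodesic_on (hspace S U) (hdist S U) {0..l} \<gamma>"
        "\<gamma> 0 = hproj S U x" "\<gamma> l = hproj S U y"
        unfolding geodesic_segment_def by blast
      define c where "c = \<gamma> (l / 2)"
      have half: "l / 2 \<in> {0..l}" "0 \<in> {0..l}" "l \<in> {0..l}" using \<gamma> by auto
      have d\<gamma>: "\<And>s t. s \<in> {0..l} \<Longrightarrow> t \<in> {0..l} \<Longrightarrow> hdist S U (\<gamma> s) (\<gamma> t) = \<bar>s - t\<bar>"
        and c_in: "c \<in> hspace S U"
        using \<gamma> half by (auto simp: geodesic_on_def c_def)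
      have c: "hdist S U c (hproj S U x) = l / 2" "hdist S U c (hproj S U y) = l / 2" "pdist S U x y = l"
        using d\<gamma>[OF half(1,2)] d\<gamma>[OF half(1,3)] d\<gamma>[OF half(2,3)] \<gamma> by (auto simp: c_def pdist_def)
      obtain m where m: "m \<in> H" "hdist S U c (hproj S U m) \<le> R" using dense c_in by blast
      have m_in: "hproj S U m \<in> hspace S U" using P HG m by blast
      have "\<bar>hdist S U (hproj S U m) p - hdist S U c p\<bar> \<le> R" if "p \<in> hspace S U" for p
        using triangle[OF m_in c_in that] triangle[OF c_in m_in that] m(2) by (simp add: commute)
      from this[OF xy_in(1)] this[OF xy_in(2)] show ?thesis
        using c m(1) by (intro bexI[of _ m]) (simp_all add: pdist_def K(1))
    qed
  qed (use E_ge_1 in \<open>auto simp: pdist_def commute\<close>)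
  define B where "B = 6 * R + 12 * (8 * E)"
  obtain p where "p \<in> hspace S U" "B + R < hdist S U p (hproj S U \<one>\<^bsub>G\<^esub>)"
    by (rule far_point[OF U P[OF one_closed], of "B + R"]) (use P in blast)
  then obtain h where h: "h \<in> H" "hdist S U p (hproj S U h) \<le> R" and p: "p \<in> hspace S U"
    "B + R < hdist S U p (hproj S U \<one>\<^bsub>G\<^esub>)" using dense by blast
  have "pdist S U h \<one>\<^bsub>G\<^esub> \<le> B"
    unfolding B_def using h subgroup.one_closed[OF H] by (intro Stab.bounded) (simp_all add: K(1))
  thus False
    using triangle[OF p(1) P[OF HG[OF h(1)]] P[OF one_closed]] h(2) p(2) by (simp add: pdist_def)
qed

end

section \<open>Word metrics on infinite groups\<close>

context group begin

lemma foldr_mult_append: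
  assumes "set vs \<subseteq> carrier G" "set ws \<subseteq> carrier G"
  shows "foldr (\<otimes>) (vs @ ws) \<one> = foldr (\<otimes>) vs \<one> \<otimes> foldr (\<otimes>) ws \<one>"
proof -
  have c: "foldr (\<otimes>) us \<one> \<in> carrier G" if "set us \<subseteq> carrier G" for us
    using that by (induction us) auto
  show ?thesis using assms(1) by (induction vs) (use c assms(2) in \<open>auto simp: m_assoc simp del: foldr_append\<close>)
qed

lemma generate_word:
  assumes A: "A \<subseteq> carrier G" and g: "g \<in> generate G A"
  shows "\<exists>ws. set ws \<subseteq> A \<union> m_inv G ` A \<and> foldr (\<otimes>) ws \<one> = g"
  using g
proof induction
  case one
  show ?case by (intro exI[of _ "[]"]) simp
next
  case (incl h)
  thus ?case using A by (intro exI[of _ "[h]"]) auto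
next
  case (inv h)
  thus ?case using A by (intro exI[of _ "[inv h]"]) auto
next
  case (eng g h)
  then obtain vs ws where "set vs \<subseteq> A \<union> m_inv G ` A" "foldr (\<otimes>) vs \<one> = g"
    "set ws \<subseteq> A \<union> m_inv G ` A" "foldr (\<otimes>) ws \<one> = h" by blast
  moreover have "A \<union> m_inv G ` A \<subseteq> carrier G" using A by auto
  ultimately show ?case
    using foldr_mult_append[of vs ws] by (intro exI[of _ "vs @ ws"]) (auto simp del: foldr_append)
qed

lemma word_metric_unbounded:
  assumes A: "finite A" "A \<subseteq> carrier G" "generate G A = carrier G" and inf: "infinite (carrier G)"
  obtains g where "g \<in> carrier G" "r < word_metric G A \<one> g"
proof -
  define B where "B = A \<union> m_inv G ` A"
  define n where "n = nat \<lceil>r\<rceil>"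
  have "carrier G \<subseteq> (\<lambda>ws. foldr (\<otimes>) ws \<one>) ` {ws. set ws \<subseteq> B \<and> length ws \<le> n}"
    if "\<And>g. g \<in> carrier G \<Longrightarrow> word_length G A g \<le> n"
  proof
    fix g assume g: "g \<in> carrier G"
    obtain vs where "set vs \<subseteq> B" "foldr (\<otimes>) vs \<one> = g"
      using generate_word A g unfolding B_def by blast
    hence "\<exists>ws. length ws = word_length G A g \<and> set ws \<subseteq> B \<and> foldr (\<otimes>) ws \<one> = g"
      unfolding word_length_def B_def by (intro LeastI) auto
    thus "g \<in> (\<lambda>ws. foldr (\<otimes>) ws \<one>) ` {ws. set ws \<subseteq> B \<and> length ws \<le> n}"
      using that[OF g] by force
  qed
  moreover have "finite {ws. set ws \<subseteq> B \<and> length ws \<le> n}"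
    using A(1) by (intro finite_lists_length_le) (simp add: B_def)
  ultimately have "\<not> (\<forall>g\<in>carrier G. word_length G A g \<le> n)"
    using inf by (meson finite_surj)
  then obtain g where g: "g \<in> carrier G" "n < word_length G A g" by (auto simp: not_le)
  hence "r < word_metric G A \<one> g" unfolding word_metric_def n_def by simp linarith
  thus thesis using that g by blast
qed

end

section \<open>Torsion groups are not hierarchically hyperbolic\<close>

theorem corollary4p1:
  fixes G :: "('g, 'b) monoid_scheme"
  assumes "group G" and "infinite (carrier G)"
    and torsion: "\<forall>g\<in>carrier G. \<exists>n::nat. n > 0 \<and> g [^]\<^bsub>G\<^esub> n = \<one>\<^bsub>G\<^esub>"
  shows "\<not> (\<exists>S :: ('g, 'u, 'p) hhs_structure. hierarchically_hyperbolic_group G S)"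
proof
  assume "\<exists>S :: ('g, 'u, 'p) hhs_structure. hierarchically_hyperbolic_group G S"
  then obtain S :: "('g, 'u, 'p) hhs_structure" and A E act isom
    where A: "finite A" "A \<subseteq> carrier G" "generate G A = carrier G"
      and hhs: "hierarchically_hyperbolic_space (carrier G) (word_metric G A) S E"
      and hhg: "hhg_action G S act isom"
      and dichotomy: "\<forall>U\<in>domains S. diam (hdist S U) (hspace S U) > ennreal E \<longrightarrow>
            diam (hdist S U) (hspace S U) = \<infinity>"
    unfolding hierarchically_hyperbolic_group_def by blast
  interpret group G by fact
  interpret hhg_dichotomy G "word_metric G A" S E act isom
    using hhs hhg dichotomy is_group
    by (simp add: hhg_dichotomy_def hhs_dichotomy_def hhs_dichotomy_axioms_def)
  obtain \<theta> where \<theta>: "\<And>x y. \<lbrakk>x \<in> carrier G; y \<in> carrier G; \<theta> < word_metric G A x y\<rbrakk> \<Longrightarrow>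
      \<exists>U\<in>domains S. E < pdist S U x y"
    using uniqueness by blast
  obtain g where g: "g \<in> carrier G" "\<theta> < word_metric G A \<one>\<^bsub>G\<^esub> g"
    using word_metric_unbounded[OF A assms(2)] by blast
  obtain U where U: "U \<in> domains S" "E < pdist S U \<one>\<^bsub>G\<^esub> g" using \<theta>[OF one_closed g] by blast
  have "ennreal E < diam (hdist S U) (hspace S U)"
    using U proj_in[OF U(1)] g E_ge_1 by (intro dist_less_imp_diam) (auto simp: pdist_def)
  hence "U \<in> unbounded_domains S" using bounded_or_unbounded U by (simp add: unbounded_domains_def)
  then obtain W where "W \<in> \<MM>"
    using exists_maximal_above[of "unbounded_domains S" U]
    by (auto simp: max_unbounded_def unbounded_domains_def)
  thus False using max_unbounded_empty_if_torsion torsion by blast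
qed

end
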